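(* Let $R$ be the restriction map $Ru=\{(u(x_m),\partial_nu(x_m))\}_{m\ge1}$. (1) $R:\mathrm{dom}_{L^\infty}\Delta(SG)\to\mathcal T_\infty$ is bounded and there are constants $C_1,C_2$ such that for all $u\in\mathrm{dom}_{L^\infty}\Delta(SG)$ $$\|Ru\|_{\mathcal T_\infty}\le C_1\|u\|_{L^\infty(SG)}+C_2\|\Delta u\|_{L^\infty(SG)} .$$ (2) $R:\mathrm{dom}_{L^2}\Delta(SG)\to\mathcal T_2$ is bounded and there are constants $C_1,C_2$ such that for all $u\in\mathrm{dom}_{L^2}\Delta(SG)$ $$\|Ru\|_{\mathcal T_2}\le C_1\|u\|_{L^\infty(SG)}+C_2\|\Delta u\|_{L^2(SG)} .$$
   Context: Let $q_0,q_1,q_2$ be the vertices of an equilateral triangle, $F_j(x)=(x+q_j)/2$, $SG$ the Sierpinski gasket ($SG=\bigcup_jF_jSG$ nonempty compact), $V_0=\{q_0,q_1,q_2\}$, $V_m=\bigcup_jF_jV_{m-1}$; $x\sim_my$ means $x\ne y$ in $V_m$ lie in a common level-$m$ cell $F_w SG=F_{w_1}\cdots F_{w_m}SG$. $\mathcal E_m(u,v)=\sum_{x\sim_my}(5/3)^m(u(x)-u(y))(v(x)-v(y))$ (unordered pairs), $\mathcal E(u,v)=\lim\mathcal E_m(u,v)$, $\mathcal E(u)=\mathcal E(u,u)$. $dx$ is the self-similar probability measure giving each level-$m$ cell measure $3^{-m}$. For $p\in\{2,\infty\}$, $\mathrm{dom}_{L^p}\Delta(SG)$ is the set of continuous $u$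 on $SG$ with $\mathcal E(u)<\infty$ for which there is $f=:\Delta u\in L^p(SG)$ with $\mathcal E(u,v)=-\int fv\,dx$ for all $v$ with $\mathcal E(v)<\infty$, $v|_{V_0}=0$. Norms: $\|u\|_{L^\infty}+\|\Delta u\|_{L^\infty}$ for $p=\infty$, and $(\|u\|_{L^2}^2+\|\Delta u\|_{L^2}^2)^{1/2}$ for $p=2$. $x_m=F_0^{m-1}F_2q_1$ $(m\ge1)$ and $X=\{x_m\}$ (points on the symmetry line through $q_0$); $\overline Y_m=F_0^{m-1}F_1SG$ is the level-$m$ cell in the left half having $x_m=F_0^{m-1}F_1q_2$ as a boundary point. The normal derivative of $u$ at a boundary point $F_wq_j$ of a level-$n$ cell $F_wSG$ is $\lim_{k}(5/3)^{n+k}[2u(F_wq_j)-u(F_wF_j^kq_{j+1})-u(F_wF_j^kq_{j-1})]$ (indices mod 3); $\partial_nu(x_m)$ is taken with respect to $\overline Y_m$. $\|c_m\|_{\mathrm{Lip}}=\sup_{m\ge1}|c_{m+1}-c_m|$ (a norm on Lipschitz sequences modulo constants). $\mathcal T_\infty$ is the set of pairs of real sequences $\{(a_m,\eta_m)\}_{m\ge1}$ with $a_m=A_1+A_2(3/5)^m+a_m'$, $\|5^ma_m'\|_{\ell^\infty}<\infty$, $\|3^m\eta_m\|_{\mathrm{Lip}}<\infty$, with $\|\{(a_m,\eta_m)\}\|_{\mathcal T_\infty}=|A_1|+|A_2|+\|5^ma_m'\|_{\ell^\infty}+\|3^m\eta_m\|_{\mathrm{Lip}}$. $\mathcal T_2$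 is the set of $\{(a_m,\eta_m)\}_{m\ge1}$ with $a_m=A_1+A_2(3/5)^m+a_m'$, $\|(25/3)^{m/2}a_m'\|_{\ell^2}<\infty$, $\|3^{m/2}\eta_m\|_{\ell^2}<\infty$, with $\|\{(a_m,\eta_m)\}\|_{\mathcal T_2}^2=|A_1|^2+|A_2|^2+\|(25/3)^{m/2}a_m'\|_{\ell^2}^2+\|3^{m/2}\eta_m\|_{\ell^2}^2$. (The constants $A_1,A_2$ are uniquely determined by $\{a_m\}$.) *)

theory Defs
  imports "HOL-Probability.Probability"
begin

section \<open>The Sierpinski gasket\<close>

text \<open>
  The indices \<open>0, 1, 2\<close> of the vertices live in the three-element type \<open>3\<close>, whose arithmetic
  is arithmetic modulo 3; so \<open>q (j + 1)\<close> and \<open>q (j - 1)\<close> need no further convention.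
  Functions on the gasket are total functions on the plane of which only the values on the
  gasket matter.
\<close>

definition equilateral :: "(3 \<Rightarrow> real^2) \<Rightarrow> bool" where
  "equilateral q \<longleftrightarrow> (\<exists>d>0. \<forall>i j. i \<noteq> j \<longrightarrow> dist (q i) (q j) = d)"

definition sg_map :: "(3 \<Rightarrow> real^2) \<Rightarrow> 3 \<Rightarrow> real^2 \<Rightarrow> real^2" where
  "sg_map q j x = (1/2) *\<^sub>R (x + q j)"

primrec sg_word :: "(3 \<Rightarrow> real^2) \<Rightarrow> 3 list \<Rightarrow> real^2 \<Rightarrow> real^2" where
  "sg_word q [] = id"
| "sg_word q (j # w) = sg_map q j \<circ> sg_word q w"

definition SG :: "(3 \<Rightarrow> real^2) \<Rightarrow> (real^2) set" where
  "SG q = (THE K. K \<noteq> {} \<and> compact K \<and> K = (\<Union>j. sg_map q j ` K))"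

primrec sg_vertices :: "(3 \<Rightarrow> real^2) \<Rightarrow> nat \<Rightarrow> (real^2) set" where
  "sg_vertices q 0 = range q"
| "sg_vertices q (Suc m) = (\<Union>j. sg_map q j ` sg_vertices q m)"

definition sg_adj :: "(3 \<Rightarrow> real^2) \<Rightarrow> nat \<Rightarrow> real^2 \<Rightarrow> real^2 \<Rightarrow> bool" where
  "sg_adj q m x y \<longleftrightarrow> x \<in> sg_vertices q m \<and> y \<in> sg_vertices q m \<and> x \<noteq> y \<and>
     (\<exists>w. length w = m \<and> x \<in> sg_word q w ` SG q \<and> y \<in> sg_word q w ` SG q)"

section \<open>Energy\<close>

text \<open>The factor \<open>1/2\<close> turns the sum over ordered pairs into one over unordered pairs.\<close>

definition sg_energy_level ::
    "(3 \<Rightarrow> real^2) \<Rightarrow> nat \<Rightarrow> (real^2 \<Rightarrow> real) \<Rightarrow> (real^2 \<Rightarrow> real) \<Rightarrow> real" where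
  "sg_energy_level q m u v =
     (1/2) * (\<Sum>(x, y) \<in> {(x, y). sg_adj q m x y}. (5/3)^m * (u x - u y) * (v x - v y))"

definition sg_energy :: "(3 \<Rightarrow> real^2) \<Rightarrow> (real^2 \<Rightarrow> real) \<Rightarrow> (real^2 \<Rightarrow> real) \<Rightarrow> real" where
  "sg_energy q u v = lim (\<lambda>m. sg_energy_level q m u v)"

text \<open>
  \<open>sg_energy_level q m u u\<close> is nondecreasing in \<open>m\<close>, so its limit always exists in
  \<open>[0, \<infinity>]\<close>, and it is finite iff the sequence converges in the reals.
\<close>

definition sg_dom_energy :: "(3 \<Rightarrow> real^2) \<Rightarrow> (real^2 \<Rightarrow> real) set" where
  "sg_dom_energy q =
     {u. continuous_on (SG q) u \<and> convergent (\<lambda>m. sg_energy_level q m u u)}"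

section \<open>Measure and Lebesgue spaces\<close>

text \<open>The underlying space of the measure is the gasket itself, with its Borel sets.\<close>

definition sg_self_similar_measure :: "(3 \<Rightarrow> real^2) \<Rightarrow> (real^2) measure \<Rightarrow> bool" where
  "sg_self_similar_measure q \<mu> \<longleftrightarrow>
     sets \<mu> = sets (restrict_space borel (SG q)) \<and> prob_space \<mu> \<and>
     (\<forall>A \<in> sets \<mu>. measure \<mu> A = (\<Sum>j\<in>UNIV. (1/3) * measure \<mu> (sg_map q j -` A \<inter> SG q))) \<and>
     (\<forall>w. measure \<mu> (sg_word q w ` SG q) = (1/3) ^ length w)"

definition L2_space :: "'a measure \<Rightarrow> ('a \<Rightarrow> real) set" where
  "L2_space \<mu> = {f \<in> borel_measurable \<mu>. integrable \<mu> (\<lambda>x. (f x)\<^sup>2)}"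

definition L2_norm :: "'a measure \<Rightarrow> ('a \<Rightarrow> real) \<Rightarrow> real" where
  "L2_norm \<mu> f = sqrt (LINT x|\<mu>. (f x)\<^sup>2)"

definition Linf_space :: "'a measure \<Rightarrow> ('a \<Rightarrow> real) set" where
  "Linf_space \<mu> = {f \<in> borel_measurable \<mu>. esssup \<mu> (\<lambda>x. ereal \<bar>f x\<bar>) < \<infinity>}"

definition Linf_norm :: "'a measure \<Rightarrow> ('a \<Rightarrow> real) \<Rightarrow> real" where
  "Linf_norm \<mu> f = real_of_ereal (esssup \<mu> (\<lambda>x. ereal \<bar>f x\<bar>))"

section \<open>Laplacian\<close>

definition sg_weak_laplacian ::
    "(3 \<Rightarrow> real^2) \<Rightarrow> (real^2) measure \<Rightarrow> (real^2 \<Rightarrow> real) \<Rightarrow> (real^2 \<Rightarrow> real) \<Rightarrow> bool" where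
  "sg_weak_laplacian q \<mu> u f \<longleftrightarrow>
     (\<forall>v \<in> sg_dom_energy q. (\<forall>x \<in> sg_vertices q 0. v x = 0) \<longrightarrow>
        sg_energy q u v = - (LINT x|\<mu>. f x * v x))"

text \<open>
  Below, \<open>L\<close> is \<open>L2_space \<mu>\<close> or \<open>Linf_space \<mu>\<close>. The Laplacian is determined only up to
  equality almost everywhere; \<open>sg_laplacian\<close> picks a representative.
\<close>

definition sg_dom_laplacian ::
    "(3 \<Rightarrow> real^2) \<Rightarrow> (real^2) measure \<Rightarrow> (real^2 \<Rightarrow> real) set \<Rightarrow> (real^2 \<Rightarrow> real) set" where
  "sg_dom_laplacian q \<mu> L = {u \<in> sg_dom_energy q. \<exists>f \<in> L. sg_weak_laplacian q \<mu> u f}"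

definition sg_laplacian ::
    "(3 \<Rightarrow> real^2) \<Rightarrow> (real^2) measure \<Rightarrow> (real^2 \<Rightarrow> real) set \<Rightarrow> (real^2 \<Rightarrow> real) \<Rightarrow> real^2 \<Rightarrow> real" where
  "sg_laplacian q \<mu> L u = (SOME f. f \<in> L \<and> sg_weak_laplacian q \<mu> u f)"

definition dom_Linf_norm :: "(3 \<Rightarrow> real^2) \<Rightarrow> (real^2) measure \<Rightarrow> (real^2 \<Rightarrow> real) \<Rightarrow> real" where
  "dom_Linf_norm q \<mu> u = Linf_norm \<mu> u + Linf_norm \<mu> (sg_laplacian q \<mu> (Linf_space \<mu>) u)"

definition dom_L2_norm :: "(3 \<Rightarrow> real^2) \<Rightarrow> (real^2) measure \<Rightarrow> (real^2 \<Rightarrow> real) \<Rightarrow> real" where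
  "dom_L2_norm q \<mu> u =
     sqrt ((L2_norm \<mu> u)\<^sup>2 + (L2_norm \<mu> (sg_laplacian q \<mu> (L2_space \<mu>) u))\<^sup>2)"

section \<open>Normal derivatives and the restriction map\<close>

text \<open>
  The normal derivative at the boundary point \<open>sg_word q w (q j)\<close> of the cell
  \<open>sg_word q w ` SG q\<close> is the limit in \<open>k\<close> of the following quotients.
\<close>

definition normal_quotient ::
    "(3 \<Rightarrow> real^2) \<Rightarrow> (real^2 \<Rightarrow> real) \<Rightarrow> 3 list \<Rightarrow> 3 \<Rightarrow> nat \<Rightarrow> real" where
  "normal_quotient q u w j k =
     (5/3) ^ (length w + k) *
       (2 * u (sg_word q w (q j))
        - u (sg_word q w ((sg_map q j ^^ k) (q (j + 1))))
        - u (sg_word q w ((sg_map q j ^^ k) (q (j - 1)))))"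

definition normal_deriv ::
    "(3 \<Rightarrow> real^2) \<Rightarrow> (real^2 \<Rightarrow> real) \<Rightarrow> 3 list \<Rightarrow> 3 \<Rightarrow> real" where
  "normal_deriv q u w j = lim (normal_quotient q u w j)"

text \<open>Sequences are indexed by \<open>m \<ge> 1\<close>; their values at \<open>0\<close> are never used.\<close>

definition X_point :: "(3 \<Rightarrow> real^2) \<Rightarrow> nat \<Rightarrow> real^2" where
  "X_point q m = (sg_map q 0 ^^ (m - 1)) (sg_map q 2 (q 1))"

definition Y_word :: "nat \<Rightarrow> 3 list" where
  "Y_word m = replicate (m - 1) 0 @ [1]"

text \<open>
  As a boundary point of the cell with word \<open>Y_word m\<close>, the point \<open>X_point q m\<close> is
  \<open>sg_word q (Y_word m) (q 2)\<close>.
\<close>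

definition sg_restriction ::
    "(3 \<Rightarrow> real^2) \<Rightarrow> (real^2 \<Rightarrow> real) \<Rightarrow> (nat \<Rightarrow> real) \<times> (nat \<Rightarrow> real)" where
  "sg_restriction q u = (\<lambda>m. u (X_point q m), \<lambda>m. normal_deriv q u (Y_word m) 2)"

section \<open>Trace spaces\<close>

definition in_linf :: "(nat \<Rightarrow> real) \<Rightarrow> bool" where
  "in_linf c \<longleftrightarrow> bdd_above ((\<lambda>m. \<bar>c m\<bar>) ` {1..})"

definition linf_norm :: "(nat \<Rightarrow> real) \<Rightarrow> real" where
  "linf_norm c = (SUP m\<in>{1..}. \<bar>c m\<bar>)"

definition in_l2 :: "(nat \<Rightarrow> real) \<Rightarrow> bool" where
  "in_l2 c \<longleftrightarrow> (\<lambda>m. (c m)\<^sup>2) summable_on {1..}"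

definition l2_norm :: "(nat \<Rightarrow> real) \<Rightarrow> real" where
  "l2_norm c = sqrt (\<Sum>\<^sub>\<infinity>m\<in>{1..}. (c m)\<^sup>2)"

definition in_Lip :: "(nat \<Rightarrow> real) \<Rightarrow> bool" where
  "in_Lip c \<longleftrightarrow> bdd_above ((\<lambda>m. \<bar>c (m + 1) - c m\<bar>) ` {1..})"

definition Lip_norm :: "(nat \<Rightarrow> real) \<Rightarrow> real" where
  "Lip_norm c = (SUP m\<in>{1..}. \<bar>c (m + 1) - c m\<bar>)"

text \<open>\<open>remainder a A1 A2\<close> is the sequence \<open>a'\<close> in \<open>a m = A1 + A2 * (3/5)^m + a' m\<close>.\<close>

definition remainder :: "(nat \<Rightarrow> real) \<Rightarrow> real \<Rightarrow> real \<Rightarrow> nat \<Rightarrow> real" where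
  "remainder a A1 A2 m = a m - (A1 + A2 * (3/5)^m)"

definition T_inf :: "((nat \<Rightarrow> real) \<times> (nat \<Rightarrow> real)) set" where
  "T_inf = {(a, \<eta>). (\<exists>A1 A2. in_linf (\<lambda>m. 5^m * remainder a A1 A2 m)) \<and> in_Lip (\<lambda>m. 3^m * \<eta> m)}"

definition T_inf_norm :: "(nat \<Rightarrow> real) \<times> (nat \<Rightarrow> real) \<Rightarrow> real" where
  "T_inf_norm = (\<lambda>(a, \<eta>).
     let (A1, A2) = (THE (A1, A2). in_linf (\<lambda>m. 5^m * remainder a A1 A2 m))
     in \<bar>A1\<bar> + \<bar>A2\<bar> + linf_norm (\<lambda>m. 5^m * remainder a A1 A2 m) + Lip_norm (\<lambda>m. 3^m * \<eta> m))"

definition T_2 :: "((nat \<Rightarrow> real) \<times> (nat \<Rightarrow> real)) set" where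
  "T_2 = {(a, \<eta>). (\<exists>A1 A2. in_l2 (\<lambda>m. (25/3) powr (real m / 2) * remainder a A1 A2 m)) \<and>
                   in_l2 (\<lambda>m. 3 powr (real m / 2) * \<eta> m)}"

definition T_2_norm :: "(nat \<Rightarrow> real) \<times> (nat \<Rightarrow> real) \<Rightarrow> real" where
  "T_2_norm = (\<lambda>(a, \<eta>).
     let (A1, A2) = (THE (A1, A2). in_l2 (\<lambda>m. (25/3) powr (real m / 2) * remainder a A1 A2 m))
     in sqrt (\<bar>A1\<bar>\<^sup>2 + \<bar>A2\<bar>\<^sup>2 + (l2_norm (\<lambda>m. (25/3) powr (real m / 2) * remainder a A1 A2 m))\<^sup>2
              + (l2_norm (\<lambda>m. 3 powr (real m / 2) * \<eta> m))\<^sup>2))"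

end

theory Submission
  imports Defs
begin

text \<open>
  The proof reads the trace off from exact linear recursions along the cells that shrink to the
  corner \<open>q 0\<close>, in which the Laplacian of \<open>u\<close> enters as a small perturbation.

  The weak Laplacian is tested against \<^emph>\<open>tents\<close>: in a cell, the piecewise harmonic function that is
  1 at one of its three junctions and vanishes outside the cell. The energy of \<open>u\<close> against a tent is a
  graph Laplacian at that junction (\<open>energy_ext_tent\<close>), so the three junction values of any cell are
  given by the 1/5-2/5 rule for harmonic functions, up to integrals of \<open>\<Delta>u\<close> against the three tents
  (\<open>junction_value\<close>). These integrals are the \<^emph>\<open>loads\<close>. This replaces Green functions and the
  Gauss-Green formula.

  Near \<open>q 0\<close> the data of \<open>u\<close> on the cell of level \<open>n\<close> split into the constant \<open>u (q 0)\<close>, a symmetric part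
  that scales by 3/5, and an antisymmetric part that scales by 1/5. The symmetric part is, up to
  scaling, the quotient defining the normal derivative at \<open>q 0\<close>, which changes with \<open>n\<close> only by loads (\<open>quotient_Suc\<close>); if \<open>\<nu>\<close> is
  its limit, then \<open>u\<close> at \<open>x\<^sub>m\<close> is \<open>u (q 0) - 2/3 * \<nu> * (3/5)^m\<close> up to a remainder made of loads
  (\<open>trace_value\<close>). The antisymmetric part, multiplied by \<open>(5/3)^n\<close>, obeys a recursion with factor
  1/3 driven by loads (\<open>skew_Suc\<close>), and up to sign and loads it is the normal derivative at \<open>x\<^sub>m\<close>
  (\<open>trace_normal_derivative\<close>).

  What remains is to sum loads. A tent of level \<open>n\<close> has integral at most \<open>3^-n\<close>. If \<open>\<Delta>u\<close> is bounded
  this bounds the loads, and geometric series give the first part (\<open>trace_Linf\<close>). If \<open>\<Delta>u\<close> is square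
  integrable, Cauchy-Schwarz bounds \<open>3^n\<close> times the squared load by the integral of \<open>(\<Delta>u)\<^sup>2\<close> times the
  tent. The tents of all scales at \<open>q 0\<close> have bounded sum (\<open>tent_sum_le\<close>), hence these numbers are
  summable; a discrete Hardy inequality (\<open>weighted_hardy\<close>) and a damping estimate
  (\<open>weighted_damping\<close>) carry the summability over to the trace (\<open>trace_L2\<close>).

  The bounds obtained in this way involve the three corner values of \<open>u\<close>. By a minimum principle with loads
  these are at most a multiple of the square norms of \<open>u\<close> and \<open>\<Delta>u\<close> (\<open>corner_values\<close>). On a
  probability space square norms are at most supremum norms, so that this single estimate yields all
  inequalities of the theorem.
\<close>

section \<open>Geometry of the gasket\<close>

lemma three_vertices: "(UNIV::3 set) = {j, j + 1, j + 2}"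
proof -
  have "j = 0 \<or> j = 1 \<or> j = 2" using exhaust_3[of j] by auto
  then show ?thesis unfolding UNIV_3 by auto
qed

lemma three_distinct [simp]:
  "j + 1 \<noteq> (j::3)" "j + 2 \<noteq> (j::3)" "j + 1 \<noteq> (j::3) + 2"
  "j \<noteq> (j::3) + 1" "j \<noteq> (j::3) + 2" "j + 2 \<noteq> (j::3) + 1"
  by auto

lemma three_add [simp]: "j + 1 + 1 = (j::3) + 2" "j + 1 + 2 = (j::3)" "j + 2 + 1 = (j::3)"
  "j + 2 + 2 = (j::3) + 1" "(j::3) - 1 = j + 2"
proof -
  have "j = 0 \<or> j = 1 \<or> j = 2" using exhaust_3[of j] by auto
  then show "j + 1 + 1 = j + 2" "j + 1 + 2 = j" "j + 2 + 1 = j" "j + 2 + 2 = j + 1" "j - 1 = j + 2"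
    by auto
qed

lemma three_values: "(0::3) + 1 = 1" "(0::3) + 2 = 2" "(1::3) + 1 = 2" "(1::3) + 2 = 0"
  "(2::3) + 1 = 0" "(2::3) + 2 = 1"
  using three_add[of 0] by simp_all

lemma sum_three: "(\<Sum>i\<in>UNIV. f i) = f j + f (j + 1) + f (j + 2)"
  for f :: "3 \<Rightarrow> 'a::comm_monoid_add"
  by (subst three_vertices[of j]) (simp add: add.assoc)

lemma three_cases:
  obtains "i = j" | "i = j + 1" | "i = (j::3) + 2"
  using three_vertices[of j] by blast

lemma all_three: "(\<forall>i. P i) \<longleftrightarrow> P j \<and> P (j + 1) \<and> P ((j::3) + 2)"
  by (metis three_cases)

definition sg_inv :: "(3 \<Rightarrow> real^2) \<Rightarrow> 3 \<Rightarrow> real^2 \<Rightarrow> real^2" where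
  "sg_inv q j x = 2 *\<^sub>R x - q j"

lemma sg_inv_map [simp]: "sg_inv q j (sg_map q j x) = x"
  by (simp add: sg_inv_def sg_map_def)

lemma sg_map_eq_iff [simp]: "sg_map q j x = sg_map q j y \<longleftrightarrow> x = y"
  by (metis sg_inv_map)

lemma sg_map_fixes [simp]: "sg_map q j (q j) = q j"
  by (simp add: sg_map_def flip: scaleR_2)

lemma sg_map_swap: "sg_map q i (q j) = sg_map q j (q i)"
  by (simp add: sg_map_def add.commute)

lemma continuous_sg_map [continuous_intros]: "continuous_on A (sg_map q j)"
  unfolding sg_map_def[abs_def] by (intro continuous_intros)

lemma continuous_sg_inv [continuous_intros]: "continuous_on A (sg_inv q j)"
  unfolding sg_inv_def[abs_def] by (intro continuous_intros)

lemma dist_sg_map: "dist (sg_map q j x) (sg_map q j y) = dist x y / 2"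
proof -
  have "sg_map q j x - sg_map q j y = (1/2) *\<^sub>R (x - y)"
    by (simp add: sg_map_def algebra_simps)
  then show ?thesis by (simp add: dist_norm)
qed

lemma closure_sg_map: "sg_map q j ` closure A = closure (sg_map q j ` A)"
proof -
  have *: "sg_map q j ` B = (+) ((1/2) *\<^sub>R q j) ` (*\<^sub>R) (1/2) ` B" for B
    by (auto simp: sg_map_def image_image algebra_simps)
  show ?thesis unfolding * by (simp add: closure_translation closure_scaleR)
qed

text \<open>A point of \<open>K\<close> farthest from \<open>L\<close> is the image of another point of \<open>K\<close>, and the maps halve
  distances; so the farthest distance is at most half of itself.\<close>

lemma attractor_subset:
  assumes K: "compact K" "K \<noteq> {}" "K = (\<Union>j. sg_map q j ` K)"
    and L: "compact L" "L \<noteq> {}" "L = (\<Union>j. sg_map q j ` L)"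
  shows "K \<subseteq> L"
proof -
  have "continuous_on K (\<lambda>x. infdist x L)" by (intro continuous_intros)
  then obtain x where x: "x \<in> K" "\<And>y. y \<in> K \<Longrightarrow> infdist y L \<le> infdist x L"
    using continuous_attains_sup[OF K(1,2)] by blast
  obtain j y where y: "y \<in> K" "x = sg_map q j y" using x(1) K(3) by blast
  obtain z where z: "z \<in> L" "infdist y L = dist y z"
    using infdist_attains_inf[OF compact_imp_closed[OF L(1)] L(2)] by blast
  have "sg_map q j z \<in> L" using z(1) L(3) by blast
  then have "infdist x L \<le> dist x (sg_map q j z)" by (rule infdist_le)
  also have "\<dots> = infdist y L / 2" using y z dist_sg_map by simp
  also have "\<dots> \<le> infdist x L / 2" using x(2)[OF y(1)] by simp
  finally have "infdist x L \<le> 0" using infdist_nonneg[of x L] by linarith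
  then have "infdist w L = 0" if "w \<in> K" for w
    using x(2)[OF that] infdist_nonneg[of w L] by linarith
  then show ?thesis
    using in_closed_iff_infdist_zero[OF compact_imp_closed[OF L(1)] L(2)] by blast
qed

locale gasket =
  fixes q :: "3 \<Rightarrow> real^2"
  assumes equilateral: "equilateral q"
begin

abbreviation "F \<equiv> sg_map q"
abbreviation "G \<equiv> sg_inv q"
abbreviation "K \<equiv> SG q"
abbreviation "V \<equiv> sg_vertices q"
abbreviation "W \<equiv> sg_word q"

text \<open>Barycentric coordinates: the foot of the altitude through \<open>q k\<close> is the midpoint of the
  opposite side, and the altitude has squared length \<open>3/4\<close> of that of a side.\<close>

definition bary :: "3 \<Rightarrow> real^2 \<Rightarrow> real" where
  "bary k x = 4 / (3 * (dist (q 0) (q 1))\<^sup>2) *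
     ((x - (1/2) *\<^sub>R (q (k + 1) + q (k + 2))) \<bullet> (q k - (1/2) *\<^sub>R (q (k + 1) + q (k + 2))))"

lemma side:
  assumes "i \<noteq> j"
  shows "dist (q i) (q j) = dist (q 0) (q 1)"
  using equilateral assms unfolding equilateral_def by (metis zero_neq_one)

lemma side_pos: "dist (q 0) (q 1) > 0"
  using equilateral unfolding equilateral_def by (metis zero_neq_one)

lemma bary_vertex [simp]: "bary k (q j) = (if j = k then 1 else 0)"
proof -
  define d where "d = dist (q 0) (q 1)"
  define a b where "a = q (k + 1) - q k" and "b = q (k + 2) - q k"
  have "dist (q (k + 1)) (q k) = d" "dist (q (k + 2)) (q k) = d" "dist (q (k + 1)) (q (k + 2)) = d"
    unfolding d_def by (rule side; simp)+
  then have "norm a = d" "norm b = d" "norm (a - b) = d"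
    unfolding a_def b_def by (simp_all add: dist_norm)
  then have ip: "a \<bullet> a = d\<^sup>2" "b \<bullet> b = d\<^sup>2" "(a - b) \<bullet> (a - b) = d\<^sup>2"
    by (metis power2_norm_eq_inner)+
  then have ab: "a \<bullet> b = d\<^sup>2 / 2" "b \<bullet> a = d\<^sup>2 / 2"
    by (auto simp: inner_diff_left inner_diff_right inner_commute)
  have d: "d \<noteq> 0" using side_pos d_def by simp
  have hlf: "x = (1/2) *\<^sub>R (x + x)" for x :: "real^2" by (simp flip: scaleR_2)
  have foot: "q k - (1/2) *\<^sub>R (q (k + 1) + q (k + 2)) = - ((1/2) *\<^sub>R (a + b))"
    unfolding a_def b_def by (subst (1) hlf) (simp add: algebra_simps)
  have 1: "q (k + 1) - (1/2) *\<^sub>R (q (k + 1) + q (k + 2)) = (1/2) *\<^sub>R (a - b)"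
    unfolding a_def b_def by (subst (1) hlf) (simp add: algebra_simps)
  have 2: "q (k + 2) - (1/2) *\<^sub>R (q (k + 1) + q (k + 2)) = (1/2) *\<^sub>R (b - a)"
    unfolding a_def b_def by (subst (1) hlf) (simp add: algebra_simps)
  show ?thesis
  proof (cases rule: three_cases[of j k])
    assume "j = k"
    then show ?thesis unfolding bary_def foot d_def[symmetric]
      using d by (simp only: foot inner_add_left inner_add_right ip ab inner_minus_left
          inner_minus_right inner_scaleR_left inner_scaleR_right) simp
  next
    assume "j = k + 1"
    then show ?thesis unfolding bary_def foot d_def[symmetric]
      by (simp add: 1 inner_add_left inner_add_right inner_diff_left ip ab)
  next
    assume "j = k + 2"
    then show ?thesis unfolding bary_def foot d_def[symmetric]
      by (simp add: 2 inner_add_left inner_add_right inner_diff_left ip ab)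
  qed
qed

lemma bary_map [simp]: "bary k (F j x) = (bary k x + (if j = k then 1 else 0)) / 2"
proof -
  have *: "F j x - c = (1/2) *\<^sub>R (x - c) + (1/2) *\<^sub>R (q j - c)" for c
    by (simp add: sg_map_def vec_eq_iff field_simps)
  have "bary k (F j x) = (bary k x + bary k (q j)) / 2"
    unfolding bary_def * inner_add_left inner_scaleR_left by argo
  then show ?thesis by simp
qed

lemma continuous_bary [continuous_intros]: "continuous_on A (bary k)"
  unfolding bary_def[abs_def] by (intro continuous_intros)

text \<open>The closed triangle with corners \<open>q\<close>, in the form in which it is used: the coordinates are
  the weights of a convex combination.\<close>

definition triangle :: "(real^2) set" where
  "triangle = {x. (\<forall>k. bary k x \<in> {0..1}) \<and> (\<Sum>k\<in>UNIV. bary k x) = 1 \<and> x = (\<Sum>k\<in>UNIV. bary k x *\<^sub>R q k)}"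

lemma
  assumes "x \<in> triangle"
  shows triangle_bary: "bary k x \<in> {0..1}"
    and triangle_sum: "(\<Sum>k\<in>UNIV. bary k x) = 1"
    and triangle_point: "x = (\<Sum>k\<in>UNIV. bary k x *\<^sub>R q k)"
  using assms unfolding triangle_def by blast+

lemma vertices_in_triangle: "V m \<subseteq> triangle"
proof (induction m)
  case 0
  have "(\<Sum>k\<in>UNIV. bary k (q j) *\<^sub>R q k) = (\<Sum>k\<in>UNIV. if k = j then q k else 0)" for j
    by (rule sum.cong) auto
  then show ?case by (auto simp: triangle_def)
next
  case (Suc m)
  have "F j x \<in> triangle" if "x \<in> triangle" for j x
  proof -
    have "(\<Sum>k\<in>UNIV. bary k (F j x) *\<^sub>R q k)
        = (\<Sum>k\<in>UNIV. (1/2) *\<^sub>R (bary k x *\<^sub>R q k) + (if k = j then (1/2) *\<^sub>R q k else 0))"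
      by (rule sum.cong) (auto simp: algebra_simps scaleR_add_left add_divide_distrib)
    also have "\<dots> = (1/2) *\<^sub>R (\<Sum>k\<in>UNIV. bary k x *\<^sub>R q k) + (1/2) *\<^sub>R q j"
      by (simp add: sum.distrib scaleR_sum_right)
    also have "\<dots> = (1/2) *\<^sub>R (x + q j)"
      using that unfolding triangle_def by (simp add: scaleR_add_right)
    finally have 1: "(\<Sum>k\<in>UNIV. bary k (F j x) *\<^sub>R q k) = F j x"
      unfolding sg_map_def .
    have "(\<Sum>k\<in>UNIV. bary k (F j x)) = (\<Sum>k\<in>UNIV. bary k x / 2 + (if k = j then 1/2 else 0))"
      by (rule sum.cong) (auto simp: add_divide_distrib)
    also have "\<dots> = 1" using that unfolding triangle_def
      by (simp add: sum.distrib flip: sum_divide_distrib)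
    finally have 2: "(\<Sum>k\<in>UNIV. bary k (F j x)) = 1" .
    have "bary k x \<in> {0..1}" for k using that unfolding triangle_def by blast
    then have "0 \<le> bary k x" "bary k x \<le> 1" for k by simp_all
    from this this(2)[THEN order_trans[of _ _ "2::real"]] have "bary k (F j x) \<in> {0..1}" for k by simp
    then show ?thesis using 1 2 unfolding triangle_def by simp
  qed
  then show ?case using Suc by auto
qed

lemma compact_triangle: "compact triangle"
  unfolding compact_eq_bounded_closed
proof
  show "bounded triangle"
    unfolding bounded_iff
  proof (intro exI ballI)
    fix x assume x: "x \<in> triangle"
    have "x = (\<Sum>k\<in>UNIV. bary k x *\<^sub>R q k)" using x unfolding triangle_def by blast
    then have "norm x = norm (\<Sum>k\<in>UNIV. bary k x *\<^sub>R q k)" by (rule arg_cong)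
    also have "\<dots> \<le> (\<Sum>k\<in>UNIV. norm (q k))"
    proof (rule sum_norm_le)
      fix k
      have "0 \<le> bary k x" "bary k x \<le> 1" using x unfolding triangle_def by auto
      then show "norm (bary k x *\<^sub>R q k) \<le> norm (q k)"
        by (simp add: mult_left_le_one_le)
    qed
    finally show "norm x \<le> (\<Sum>k\<in>UNIV. norm (q k))" .
  qed
  show "closed triangle"
    unfolding triangle_def atLeastAtMost_iff
    by (intro closed_Collect_conj closed_Collect_all closed_Collect_le closed_Collect_eq
        continuous_intros)
qed

lemma vertices_mono_Suc: "V m \<subseteq> V (Suc m)"
proof (induction m)
  case 0
  have "q j \<in> V (Suc 0)" for j
  proof -
    have "F j (q j) \<in> F j ` V 0" by (intro imageI) simp
    then have "q j \<in> F j ` V 0" unfolding sg_map_fixes .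
    then show ?thesis unfolding sg_vertices.simps(2) by (rule UN_I[OF UNIV_I])
  qed
  then show ?case by auto
next
  case (Suc m)
  then show ?case
    unfolding sg_vertices.simps(2)[of q m] sg_vertices.simps(2)[of q "Suc m"]
    by (intro UN_mono image_mono order_refl)
qed

lemma closure_vertices_invariant: "closure (\<Union>m. V m) = (\<Union>j. F j ` closure (\<Union>m. V m))"
proof -
  have "(\<Union>j. F j ` closure (\<Union>m. V m)) = (\<Union>j. closure (F j ` (\<Union>m. V m)))"
    by (simp add: closure_sg_map)
  also have "\<dots> = closure (\<Union>j. F j ` (\<Union>m. V m))"
    unfolding UNIV_3 by (simp add: closure_Un)
  also have "(\<Union>j. F j ` (\<Union>m. V m)) = (\<Union>m. V (Suc m))" by auto
  also have "(\<Union>m. V (Suc m)) = (\<Union>m. V m)"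
  proof
    show "(\<Union>m. V m) \<subseteq> (\<Union>m. V (Suc m))" by (rule UN_mono[OF order_refl vertices_mono_Suc])
    show "(\<Union>m. V (Suc m)) \<subseteq> (\<Union>m. V m)" by (rule UN_least) (rule UN_upper[OF UNIV_I])
  qed
  finally show ?thesis ..
qed

lemma SG_closure: "K = closure (\<Union>m. V m)"
proof -
  let ?L = "closure (\<Union>m. V m)"
  have "?L \<subseteq> triangle"
    by (rule closure_minimal) (use vertices_in_triangle compact_imp_closed[OF compact_triangle] in auto)
  then have c: "compact ?L"
    using compact_triangle closed_Int_compact[of ?L triangle] by (simp add: Int_absorb2)
  have "q 0 \<in> V 0" by simp
  then have n: "?L \<noteq> {}" using closure_subset[of "\<Union>m. V m"] by blast
  show ?thesis unfolding SG_def
  proof (rule the_equality, intro conjI)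
    show "?L = (\<Union>j. F j ` ?L)" by (rule closure_vertices_invariant)
    show "L = ?L" if L: "L \<noteq> {} \<and> compact L \<and> L = (\<Union>j. F j ` L)" for L
    proof
      show "L \<subseteq> ?L" by (rule attractor_subset[OF _ _ _ c n closure_vertices_invariant]) (use L in simp_all)
      show "?L \<subseteq> L" by (rule attractor_subset[OF c n closure_vertices_invariant]) (use L in simp_all)
    qed
  qed (fact c n)+
qed

lemma SG_subset_triangle: "K \<subseteq> triangle"
  unfolding SG_closure
  by (rule closure_minimal) (use vertices_in_triangle compact_imp_closed[OF compact_triangle] in auto)

lemma compact_SG: "compact K"
  using compact_triangle closed_Int_compact[of K triangle] SG_subset_triangle SG_closure
  by (metis Int_absorb2 closed_closure)

lemma SG_invariant: "K = (\<Union>j. F j ` K)"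
  using closure_vertices_invariant unfolding SG_closure[symmetric] .

lemma map_in_SG [intro, simp]: "x \<in> K \<Longrightarrow> F j x \<in> K"
  by (subst SG_invariant) (rule UN_I[OF UNIV_I], rule imageI)

lemma SG_cases:
  assumes "x \<in> K" obtains j y where "y \<in> K" "x = F j y"
proof -
  have "x \<in> (\<Union>j. F j ` K)" using assms by (subst (asm) SG_invariant)
  then show ?thesis by (elim UN_E imageE) (rule that)
qed

lemma vertices_in_SG: "V m \<subseteq> K"
  unfolding SG_closure by (rule order_trans[OF UN_upper[OF UNIV_I] closure_subset])

lemma vertex_in_SG [intro, simp]: "q j \<in> K" by (rule subsetD[OF vertices_in_SG[of 0]]) simp

text \<open>Two cells meet only in a junction: the coordinate \<open>j\<close> is at least 1/2 on the cell \<open>j\<close> and at most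
  1/2 on the cell \<open>i\<close>, where it attains 1/2 only at the image of \<open>q j\<close>.\<close>

lemma map_eq_iff:
  assumes "x \<in> K" "y \<in> K" "i \<noteq> j"
  shows "F i x = F j y \<longleftrightarrow> x = q j \<and> y = q i"
proof
  assume e: "F i x = F j y"
  have *: "x = q j" if x: "x \<in> K" and y: "y \<in> K" and e: "F i x = F j y" and "i \<noteq> j" for i j x y
  proof -
    have h: "x \<in> triangle" "y \<in> triangle" using x y SG_subset_triangle by blast+
    have "bary j (F i x) = bary j (F j y)" using e by (rule arg_cong)
    then have "bary j x = bary j y + 1" using \<open>i \<noteq> j\<close> unfolding bary_map by simp
    have r: "bary k x \<in> {0..1}" for k by (rule triangle_bary[OF h(1)])
    have ry: "bary k y \<in> {0..1}" for k by (rule triangle_bary[OF h(2)])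
    then have b: "bary j x = 1" using \<open>bary j x = bary j y + 1\<close> r[of j] ry[of j]
      unfolding atLeastAtMost_iff by linarith
    have "bary j x + bary (j + 1) x + bary (j + 2) x = 1"
      using triangle_sum[OF h(1)] unfolding sum_three[of _ j] .
    then have "bary (j + 1) x = 0 \<and> bary (j + 2) x = 0"
      using b r[of "j + 1"] r[of "j + 2"] by simp
    moreover have "x = bary j x *\<^sub>R q j + bary (j + 1) x *\<^sub>R q (j + 1) + bary (j + 2) x *\<^sub>R q (j + 2)"
      using triangle_point[OF h(1)] unfolding sum_three[of _ j] .
    ultimately show ?thesis using b by simp
  qed
  show "x = q j \<and> y = q i"
    using *[OF assms(1,2) e assms(3)] *[OF assms(2,1) e[symmetric] assms(3)[symmetric]] by blast
qed (use sg_map_swap in metis)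

lemma vertex_eq_iff [simp]: "q i = q j \<longleftrightarrow> i = j"
  by (metis bary_vertex zero_neq_one)

lemma vertex_eq_map_iff:
  assumes "x \<in> K" shows "F i x = q j \<longleftrightarrow> i = j \<and> x = q j"
proof (cases "i = j")
  case True
  then show ?thesis by (metis sg_inv_map sg_map_fixes)
next
  case False
  then have "q j \<noteq> q i" by simp
  then have "F i x \<noteq> F j (q j)" using map_eq_iff[OF assms vertex_in_SG False, of j] by blast
  then show ?thesis using False unfolding sg_map_fixes by blast
qed

lemma word_in_SG [intro, simp]: "x \<in> K \<Longrightarrow> W w x \<in> K"
  by (induction w) auto

lemma word_append: "W (v @ w) x = W v (W w x)"
  by (induction v) auto

lemma word_replicate: "W (replicate n j) x = (F j ^^ n) x"
  by (induction n) auto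

lemma continuous_word [continuous_intros]: "continuous_on A (W w)"
proof (induction w arbitrary: A)
  case (Cons j w)
  show ?case unfolding sg_word.simps by (intro continuous_on_compose Cons continuous_sg_map)
qed (simp add: continuous_on_id)

lemma continuous_word_comp:
  "continuous_on K u \<Longrightarrow> continuous_on K (u \<circ> W w)"
  by (rule continuous_on_compose[OF continuous_word continuous_on_subset]) auto

lemma cell_closed: "closed (W w ` K)"
  by (intro compact_imp_closed compact_continuous_image compact_SG continuous_intros)

lemma cell_subset: "W w ` K \<subseteq> K" by auto


section \<open>Gluing and harmonic functions\<close>

text \<open>A function is assembled from its pullbacks \<open>g j\<close> to the three cells. A junction lies in two
  cells, and the choice made there is immaterial when the pullbacks agree on junctions, which is
  \<open>compat g\<close>.\<close>

definition glue :: "(3 \<Rightarrow> real^2 \<Rightarrow> real) \<Rightarrow> real^2 \<Rightarrow> real" where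
  "glue g x = (let j = SOME j. x \<in> F j ` K in g j (G j x))"

definition compat :: "(3 \<Rightarrow> real^2 \<Rightarrow> real) \<Rightarrow> bool" where
  "compat g \<longleftrightarrow> (\<forall>i j. g i (q j) = g j (q i))"

lemma compatI: "(\<And>i j. i \<noteq> j \<Longrightarrow> g i (q j) = g j (q i)) \<Longrightarrow> compat g"
  unfolding compat_def by metis

lemma glue_map:
  assumes "compat g" "x \<in> K"
  shows "glue g (F j x) = g j x"
proof -
  define i where "i = (SOME i. F j x \<in> F i ` K)"
  have "F j x \<in> F i ` K"
    unfolding i_def by (rule someI) (rule imageI[OF assms(2)])
  then obtain y where y: "y \<in> K" "F j x = F i y" by (elim imageE)
  have "g i (G i (F j x)) = g j x"
  proof (cases "i = j")
    case False
    then have "x = q i \<and> y = q j" using map_eq_iff[OF assms(2) y(1), of j i] y(2) by metis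
    then show ?thesis using y(2) assms(1) unfolding compat_def by (metis sg_inv_map)
  qed simp
  then show ?thesis unfolding glue_def i_def Let_def .
qed

lemma glue_vertex: "compat g \<Longrightarrow> glue g (q j) = g j (q j)"
  using glue_map[of g "q j" j] by simp

lemma continuous_glue:
  assumes "compat g" "\<And>j. continuous_on K (g j)"
  shows "continuous_on K (glue g)"
proof -
  have "continuous_on (F j ` K) (glue g)" for j
  proof -
    have "continuous_on (F j ` K) (g j \<circ> G j)"
      by (rule continuous_on_compose[OF continuous_sg_inv]) (simp add: image_image assms(2))
    moreover have "(g j \<circ> G j) x = glue g x" if "x \<in> F j ` K" for x
      using that glue_map[OF assms(1)] by auto
    ultimately show ?thesis by (metis (mono_tags, lifting) continuous_on_cong)
  qed
  moreover have "closed (F j ` K)" for j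
    by (intro compact_imp_closed compact_continuous_image compact_SG continuous_sg_map)
  ultimately have "continuous_on (\<Union>j\<in>UNIV. F j ` K) (glue g)"
    by (intro continuous_on_closed_Union) auto
  then show ?thesis using SG_invariant by metis
qed

lemma SG_induct_step:
  assumes "\<And>j y. y \<in> K \<Longrightarrow> P (F j y)" "x \<in> K"
  shows "P x"
  using assms(2) by (rule SG_cases) (metis assms(1))

text \<open>By the 1/5-2/5 rule a harmonic function with corner values \<open>a\<close> takes the value
  \<open>(2 * a i + 2 * a j + a k) / 5\<close> at the junction of cells \<open>i\<close> and \<open>j\<close>. Imposed on all cells, this
  makes the harmonic functions with corner values 0 and 1 the fixed point of the following
  operation, which is a contraction for the supremum norm.\<close>

definition harm_step :: "(3 \<Rightarrow> real^2 \<Rightarrow> real) \<Rightarrow> 3 \<Rightarrow> 3 \<Rightarrow> real^2 \<Rightarrow> real" where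
  "harm_step g k j x = (if j = k then 2/5 + 3/5 * g k x else 1/5 + (g k x - g j x) / 5)"

primrec harm_approx :: "nat \<Rightarrow> 3 \<Rightarrow> real^2 \<Rightarrow> real" where
  "harm_approx 0 k = bary k"
| "harm_approx (Suc n) k = glue (harm_step (harm_approx n) k)"

lemma compat_harm_step:
  assumes "\<And>k j. g k (q j) = (if j = k then 1 else 0)"
  shows "compat (harm_step g k)"
  by (rule compatI) (simp add: harm_step_def assms)

lemma harm_approx_vertex: "harm_approx n k (q j) = (if j = k then 1 else 0)"
proof (induction n arbitrary: k j)
  case (Suc n)
  have "harm_approx (Suc n) k (q j) = harm_step (harm_approx n) k j (q j)"
    unfolding harm_approx.simps using glue_vertex[OF compat_harm_step[OF Suc]] .
  then show ?case by (simp add: harm_step_def Suc)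
qed simp

lemma continuous_harm_approx: "continuous_on K (harm_approx n k)"
proof (induction n arbitrary: k)
  case (Suc n)
  have "continuous_on K (harm_step (harm_approx n) k j)" for j
    unfolding harm_step_def[abs_def] by (cases "j = k") (auto intro!: continuous_intros Suc)
  then show ?case
    unfolding harm_approx.simps
    by (intro continuous_glue compat_harm_step) (auto simp: harm_approx_vertex)
qed (simp add: continuous_bary)

lemma harm_approx_map:
  "x \<in> K \<Longrightarrow> harm_approx (Suc n) k (F j x) = harm_step (harm_approx n) k j x"
  unfolding harm_approx.simps using glue_map[OF compat_harm_step] harm_approx_vertex by metis

lemma harm_approx_range: "x \<in> K \<Longrightarrow> (\<forall>k. 0 \<le> harm_approx n k x) \<and> (\<Sum>k\<in>UNIV. harm_approx n k x) = 1"
proof (induction n arbitrary: x)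
  case 0
  then have "x \<in> triangle" using SG_subset_triangle by blast
  then show ?case using triangle_bary[of x] triangle_sum[of x] by auto
next
  case (Suc n)
  show ?case using Suc.prems
  proof (rule SG_induct_step[rotated])
    fix j y assume y: "y \<in> K"
    have *: "harm_approx n j y + harm_approx n (j + 1) y + harm_approx n (j + 2) y = 1"
      "\<And>k. 0 \<le> harm_approx n k y"
      using Suc.IH[OF y] unfolding sum_three[of _ j] by auto
    show "(\<forall>k. 0 \<le> harm_approx (Suc n) k (F j y)) \<and> (\<Sum>k\<in>UNIV. harm_approx (Suc n) k (F j y)) = 1"
      unfolding sum_three[of _ j] all_three[of _ j] harm_approx_map[OF y]
      using *(1) *(2)[of j] *(2)[of "j + 1"] *(2)[of "j + 2"]
      unfolding harm_step_def by (simp only: if_False if_True three_distinct refl simp_thms) argo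
  qed
qed

lemma harm_approx_diff: "x \<in> K \<Longrightarrow> \<bar>harm_approx (Suc n) k x - harm_approx n k x\<bar> \<le> (3/5)^n"
proof (induction n arbitrary: x k)
  case 0
  have r: "\<bar>harm_approx n k x\<bar> \<in> {0..1}" "harm_approx n k x \<in> {0..1}" for n
  proof -
    have "harm_approx n k x + harm_approx n (k + 1) x + harm_approx n (k + 2) x = 1"
      "\<And>k. 0 \<le> harm_approx n k x"
      using harm_approx_range[OF 0, of n] unfolding sum_three[of _ k] by auto
    from this(1) this(2)[of k] this(2)[of "k + 1"] this(2)[of "k + 2"]
    show "\<bar>harm_approx n k x\<bar> \<in> {0..1}" "harm_approx n k x \<in> {0..1}" by auto
  qed
  show ?case using r(2)[of 0] r(2)[of "Suc 0"] by (auto simp del: harm_approx.simps)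
next
  case (Suc n)
  show ?case using Suc.prems
  proof (rule SG_induct_step[rotated])
    fix j y assume y: "y \<in> K"
    have "\<bar>harm_approx (Suc n) k y - harm_approx n k y\<bar> \<le> (3/5)^n"
      "\<bar>harm_approx (Suc n) j y - harm_approx n j y\<bar> \<le> (3/5)^n"
      using Suc.IH[OF y] by blast+
    moreover have "(0::real) \<le> (3/5)^n" by simp
    ultimately show "\<bar>harm_approx (Suc (Suc n)) k (F j y) - harm_approx (Suc n) k (F j y)\<bar> \<le> (3/5)^Suc n"
      unfolding harm_approx_map[OF y] harm_step_def power_Suc abs_le_iff
      by (cases "j = k") (simp_all only: if_True if_False refl, argo+)
  qed
qed

definition corner_harmonic :: "3 \<Rightarrow> real^2 \<Rightarrow> real" where
  "corner_harmonic k x = bary k x + (\<Sum>n. harm_approx (Suc n) k x - harm_approx n k x)"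

lemma harm_uniform_limit: "uniform_limit K (\<lambda>n. harm_approx n k) (corner_harmonic k) sequentially"
proof -
  have "uniform_limit K (\<lambda>n x. \<Sum>i<n. harm_approx (Suc i) k x - harm_approx i k x)
      (\<lambda>x. \<Sum>i. harm_approx (Suc i) k x - harm_approx i k x) sequentially"
    by (rule Weierstrass_m_test[where M = "\<lambda>n. (3/5)^n"])
      (use harm_approx_diff in \<open>auto intro: summable_geometric simp del: harm_approx.simps\<close>)
  then have "uniform_limit K (\<lambda>n x. bary k x + (\<Sum>i<n. harm_approx (Suc i) k x - harm_approx i k x))
      (corner_harmonic k) sequentially"
    unfolding corner_harmonic_def[abs_def] by (intro uniform_limit_add uniform_limit_const)
  moreover have "bary k x + (\<Sum>i<n. harm_approx (Suc i) k x - harm_approx i k x) = harm_approx n k x" for n x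
    using sum_lessThan_telescope[of "\<lambda>i. harm_approx i k x" n] by (simp del: harm_approx.simps(2))
  ultimately show ?thesis by (simp del: harm_approx.simps)
qed

lemma harm_limit: "x \<in> K \<Longrightarrow> (\<lambda>n. harm_approx n k x) \<longlonglongrightarrow> corner_harmonic k x"
  by (rule tendsto_uniform_limitI[OF harm_uniform_limit])

lemma continuous_harm [continuous_intros]: "continuous_on K (corner_harmonic k)"
  by (rule uniform_limit_theorem[OF _ harm_uniform_limit]) (auto simp: continuous_harm_approx)

lemma harm_vertex [simp]: "corner_harmonic k (q j) = (if j = k then 1 else 0)"
  using harm_limit[OF vertex_in_SG, of k j] unfolding harm_approx_vertex
  by (simp add: LIMSEQ_const_iff)

lemma harm_map:
  assumes "x \<in> K" shows "corner_harmonic k (F j x) = harm_step corner_harmonic k j x"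
proof -
  have "(\<lambda>n. harm_step (harm_approx n) k j x) \<longlonglongrightarrow> harm_step corner_harmonic k j x"
    unfolding harm_step_def
    by (cases "j = k") (auto intro!: tendsto_intros harm_limit assms)
  then show ?thesis
    using LIMSEQ_Suc[OF harm_limit[OF map_in_SG[OF assms]], of k j]
    unfolding harm_approx_map[OF assms] by (rule LIMSEQ_unique[symmetric])
qed

lemma harm_sum: "x \<in> K \<Longrightarrow> corner_harmonic j x + corner_harmonic (j + 1) x + corner_harmonic (j + 2) x = 1"
proof -
  assume x: "x \<in> K"
  have "(\<lambda>n. \<Sum>k\<in>UNIV. harm_approx n k x) \<longlonglongrightarrow> (\<Sum>k\<in>UNIV. corner_harmonic k x)"
    by (intro tendsto_sum harm_limit x)
  moreover have "(\<lambda>n. \<Sum>k\<in>UNIV. harm_approx n k x) = (\<lambda>n. 1)"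
    using harm_approx_range[OF x] by blast
  ultimately show ?thesis unfolding sum_three[of _ j] by (simp add: LIMSEQ_const_iff)
qed

lemma harm_nonneg: "x \<in> K \<Longrightarrow> 0 \<le> corner_harmonic k x"
  by (rule LIMSEQ_le_const[OF harm_limit]) (use harm_approx_range in blast)+

lemma harm_le_1: "x \<in> K \<Longrightarrow> corner_harmonic k x \<le> 1"
  using harm_sum[of x k] harm_nonneg[of x "k + 1"] harm_nonneg[of x "k + 2"] by linarith

text \<open>The piecewise harmonic function that is 1 at the junction of the cells \<open>i + 1\<close> and \<open>i + 2\<close>
  and 0 at the other vertices of level 1.\<close>

definition tent_part :: "3 \<Rightarrow> 3 \<Rightarrow> real^2 \<Rightarrow> real" where
  "tent_part i j x = (if j = i then 0 else if j = i + 1 then corner_harmonic (i + 2) x else corner_harmonic (i + 1) x)"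

definition tent :: "3 \<Rightarrow> real^2 \<Rightarrow> real" where
  "tent i = glue (tent_part i)"

lemma compat_tent_part: "compat (tent_part i)"
proof (rule compatI)
  fix a b :: 3 assume "a \<noteq> b"
  then show "tent_part i a (q b) = tent_part i b (q a)"
    by (cases rule: three_cases[of a i]; cases rule: three_cases[of b i]) (simp_all add: tent_part_def)
qed

lemma tent_map: "x \<in> K \<Longrightarrow> tent i (F j x) = tent_part i j x"
  unfolding tent_def by (rule glue_map[OF compat_tent_part])

lemma tent_vertex [simp]: "tent i (q j) = 0"
  unfolding tent_def glue_vertex[OF compat_tent_part]
  by (cases rule: three_cases[of j i]) (simp_all add: tent_part_def)

lemma continuous_tent: "continuous_on K (tent i)"
  unfolding tent_def
proof (rule continuous_glue[OF compat_tent_part])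
  show "continuous_on K (tent_part i j)" for j
    unfolding tent_part_def[abs_def]
    by (rule three_cases[of j i]) (auto intro!: continuous_intros continuous_harm)
qed

lemma tent_bounds: "x \<in> K \<Longrightarrow> tent i x \<in> {0..1}"
proof (erule SG_induct_step[rotated])
  fix j y assume "y \<in> K"
  then show "tent i (F j y) \<in> {0..1}"
    using tent_map[of y i j] harm_nonneg[of y] harm_le_1[of y] by (simp add: tent_part_def)
qed

text \<open>The copy of \<open>v\<close> in the cell of the word, continued by 0. It is continuous when \<open>v\<close> vanishes at the
  three corners.\<close>

primrec cell_ext :: "3 list \<Rightarrow> (real^2 \<Rightarrow> real) \<Rightarrow> real^2 \<Rightarrow> real" where
  "cell_ext [] v = v"
| "cell_ext (j # w) v = glue (\<lambda>i. if i = j then cell_ext w v else (\<lambda>x. 0))"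

lemma
  assumes "\<And>j. v (q j) = 0"
  shows ext_vertex: "cell_ext w v (q j) = 0"
    and compat_ext: "compat (\<lambda>i. if i = k then cell_ext w v else (\<lambda>x. 0))"
proof -
  have *: "compat (\<lambda>i. if i = k then cell_ext w v else (\<lambda>x. 0))" if "\<And>j. cell_ext w v (q j) = 0" for w k
    by (rule compatI) (use that in auto)
  have "\<forall>j. cell_ext w v (q j) = 0"
  proof (induction w)
    case (Cons k w)
    then have "compat (\<lambda>i. if i = k then cell_ext w v else (\<lambda>x. 0))" by (intro *) blast
    from glue_vertex[OF this] show ?case using Cons by simp
  qed (use assms in simp)
  then show "cell_ext w v (q j) = 0" "compat (\<lambda>i. if i = k then cell_ext w v else (\<lambda>x. 0))"
    using * by blast+
qed

lemma ext_map:
  assumes "\<And>j. v (q j) = 0" "x \<in> K"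
  shows "cell_ext (j # w) v (F i x) = (if i = j then cell_ext w v x else 0)"
  unfolding cell_ext.simps glue_map[OF compat_ext[of v, OF assms(1)] assms(2)] by simp

lemma continuous_ext:
  assumes "\<And>j. v (q j) = 0" "continuous_on K v"
  shows "continuous_on K (cell_ext w v)"
proof (induction w)
  case (Cons j w)
  have "continuous_on K (if i = j then cell_ext w v else (\<lambda>x. 0))" for i using Cons by simp
  then show ?case unfolding cell_ext.simps by (rule continuous_glue[OF compat_ext[of v, OF assms(1)]])
qed (use assms in simp)

lemma ext_outside:
  assumes "\<And>j. v (q j) = 0"
  shows "x \<in> K \<Longrightarrow> x \<notin> W w ` K \<Longrightarrow> cell_ext w v x = 0"
proof (induction w arbitrary: x)
  case (Cons j w)
  obtain i y where y: "y \<in> K" "x = F i y" using SG_cases[OF Cons.prems(1)] by metis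
  have "y \<notin> W w ` K" if "i = j" using Cons.prems(2) y that by auto
  then show ?case unfolding y(2) ext_map[of v, OF assms y(1)] using Cons.IH[OF y(1)] by simp
qed simp

lemma ext_bounds:
  assumes "\<And>j. v (q j) = 0" "\<And>x. x \<in> K \<Longrightarrow> v x \<in> {0..1}"
  shows "x \<in> K \<Longrightarrow> cell_ext w v x \<in> {0..1}"
proof (induction w arbitrary: x)
  case (Cons j w)
  obtain i y where y: "y \<in> K" "x = F i y" using SG_cases[OF Cons.prems(1)] by metis
  then show ?case unfolding y(2) ext_map[of v, OF assms(1) y(1)] using Cons.IH[OF y(1)] by simp
qed (use assms in simp)


section \<open>Energy of glued functions\<close>

abbreviation "level \<equiv> sg_energy_level q"

lemma finite_vertices: "finite (V m)"
  by (induction m) auto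

lemma finite_adj: "finite {(x, y). sg_adj q m x y}"
proof (rule finite_subset)
  show "{(x, y). sg_adj q m x y} \<subseteq> V m \<times> V m" by (auto simp: sg_adj_def)
qed (use finite_vertices in blast)

lemma adj_in_SG: "sg_adj q m x y \<Longrightarrow> x \<in> K \<and> y \<in> K"
  using vertices_in_SG by (auto simp: sg_adj_def)

lemma adj_0: "{(x, y). sg_adj q 0 x y} = (\<lambda>(i, j). (q i, q j)) ` {(i, j). i \<noteq> j}"
proof -
  have "sg_adj q 0 x y \<longleftrightarrow> (\<exists>i j. i \<noteq> j \<and> x = q i \<and> y = q j)" for x y
    unfolding sg_adj_def by auto
  then show ?thesis by (auto simp: image_iff)
qed

lemma vertices_Suc_pullback:
  assumes "x \<in> K" "F j x \<in> V (Suc m)"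
  shows "x \<in> V m"
proof -
  obtain i y where y: "y \<in> V m" "F j x = F i y" using assms(2) by auto
  show ?thesis
  proof (cases "i = j")
    case False
    then have "x = q i" using map_eq_iff[OF assms(1), of y j i] vertices_in_SG y by auto
    then have "x \<in> V 0" by simp
    moreover have "V 0 \<subseteq> V m" by (induction m) (use vertices_mono_Suc in blast)+
    ultimately show ?thesis by blast
  qed (use y in auto)
qed

text \<open>As cells meet only in junctions, an edge lies in exactly one of the three cells; this makes the
  level energies self-similar.\<close>

lemma adj_Suc:
  "{(x, y). sg_adj q (Suc m) x y} = (\<Union>j. (\<lambda>(x, y). (F j x, F j y)) ` {(x, y). sg_adj q m x y})"
proof -
  have "\<exists>j x' y'. x = F j x' \<and> y = F j y' \<and> sg_adj q m x' y'" if a: "sg_adj q (Suc m) x y" for x y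
  proof -
    obtain w where w: "length w = Suc m" "x \<in> W w ` K" "y \<in> W w ` K" and xy: "x \<noteq> y"
      "x \<in> V (Suc m)" "y \<in> V (Suc m)"
      using a unfolding sg_adj_def by auto
    obtain j v where v: "w = j # v" "length v = m" using w(1) by (cases w) auto
    obtain s t where st: "s \<in> K" "t \<in> K" "x = F j (W v s)" "y = F j (W v t)"
      using w(2,3) unfolding v(1) by auto
    have "W v s \<in> V m" "W v t \<in> V m"
      using vertices_Suc_pullback[of "W v s" j m] vertices_Suc_pullback[of "W v t" j m] st xy by auto
    then have "sg_adj q m (W v s) (W v t)"
      unfolding sg_adj_def using st xy v(2) by auto
    then show ?thesis using st by blast
  qed
  moreover have "sg_adj q (Suc m) (F j x) (F j y)" if a: "sg_adj q m x y" for j x y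
  proof -
    obtain w where w: "length w = m" "x \<in> W w ` K" "y \<in> W w ` K"
      using a unfolding sg_adj_def by blast
    then have "length (j # w) = Suc m \<and> F j x \<in> W (j # w) ` K \<and> F j y \<in> W (j # w) ` K" by auto
    moreover have "F j x \<in> V (Suc m)" "F j y \<in> V (Suc m)" "F j x \<noteq> F j y"
      using a unfolding sg_adj_def by auto
    ultimately show ?thesis unfolding sg_adj_def by blast
  qed
  ultimately show ?thesis by (fastforce simp: image_iff)
qed

lemma level_0:
  "level 0 u v = (u (q j) - u (q (j + 1))) * (v (q j) - v (q (j + 1)))
    + (u (q (j + 1)) - u (q (j + 2))) * (v (q (j + 1)) - v (q (j + 2)))
    + (u (q (j + 2)) - u (q j)) * (v (q (j + 2)) - v (q j))"
proof -
  define e where "e i k = (u (q i) - u (q k)) * (v (q i) - v (q k))" for i k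
  have "(\<Sum>(x, y)\<in>{(x, y). sg_adj q 0 x y}. (5/3)^0 * (u x - u y) * (v x - v y))
      = (\<Sum>(i, k)\<in>{(i, k). i \<noteq> k}. e i k)"
    unfolding adj_0 by (subst sum.reindex) (auto simp: inj_on_def e_def intro!: sum.cong)
  also have "\<dots> = (\<Sum>(i, k)\<in>UNIV. e i k)"
    by (rule sum.mono_neutral_left) (auto simp: e_def)
  also have "\<dots> = (\<Sum>i\<in>UNIV. \<Sum>k\<in>UNIV. e i k)"
    by (simp add: sum.cartesian_product)
  finally show ?thesis
    unfolding sg_energy_level_def sum_three[of _ j] e_def by (simp add: algebra_simps)
qed

lemma level_Suc: "level (Suc m) u v = 5/3 * (\<Sum>j\<in>UNIV. level m (u \<circ> F j) (v \<circ> F j))"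
proof -
  define f where "f = (\<lambda>(x, y). (5/3)^Suc m * (u x - u y) * (v x - v y))"
  let ?A = "{(x, y). sg_adj q m x y}" and ?h = "\<lambda>j. \<lambda>(x, y). (F j x, F j y)"
  have split: "sum f {(x, y). sg_adj q (Suc m) x y} = (\<Sum>j\<in>UNIV. sum f (?h j ` ?A))"
    unfolding adj_Suc
  proof (rule sum.UNION_disjoint)
    have "False" if ij: "i \<noteq> j" and a: "sg_adj q m x y" "sg_adj q m s t" and e: "F i x = F j s" "F i y = F j t"
      for i j x y s t
    proof -
      have "x = q j" "y = q j"
        using map_eq_iff[OF _ _ ij] adj_in_SG a e by blast+
      then show False using a(1) by (simp add: sg_adj_def)
    qed
    then show "\<forall>i\<in>UNIV. \<forall>j\<in>UNIV. i \<noteq> j \<longrightarrow> ?h i ` ?A \<inter> ?h j ` ?A = {}" by fastforce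
  qed (use finite_adj in auto)
  have cell: "sum f (?h j ` ?A) = (\<Sum>(x, y)\<in>?A. (5/3)^Suc m * (u (F j x) - u (F j y)) * (v (F j x) - v (F j y)))" for j
    by (subst sum.reindex) (auto simp: inj_on_def f_def intro!: sum.cong)
  have "(\<Sum>(x, y)\<in>{(x, y). sg_adj q (Suc m) x y}. (5/3)^Suc m * (u x - u y) * (v x - v y))
    = (\<Sum>j\<in>UNIV. \<Sum>(x, y)\<in>?A. (5/3)^Suc m * (u (F j x) - u (F j y)) * (v (F j x) - v (F j y)))"
    using split unfolding cell unfolding f_def .
  then show ?thesis
    unfolding sg_energy_level_def by (simp add: sum_distrib_left case_prod_unfold mult_ac)
qed

lemma level_cong:
  assumes "\<And>x. x \<in> K \<Longrightarrow> u x = u' x" "\<And>x. x \<in> K \<Longrightarrow> v x = v' x"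
  shows "level m u v = level m u' v'"
proof -
  have "(\<Sum>(x, y)\<in>{(x, y). sg_adj q m x y}. (5/3)^m * (u x - u y) * (v x - v y))
    = (\<Sum>(x, y)\<in>{(x, y). sg_adj q m x y}. (5/3)^m * (u' x - u' y) * (v' x - v' y))"
    by (intro sum.cong refl) (auto dest!: adj_in_SG simp: assms)
  then show ?thesis unfolding sg_energy_level_def by simp
qed

lemma level_affine: "level m u (\<lambda>x. a + b * f x + c * g x) = b * level m u f + c * level m u g"
  unfolding sg_energy_level_def
  by (simp add: sum_distrib_left case_prod_unfold algebra_simps flip: sum.distrib sum_subtractf)

lemma level_zero: "level m u (\<lambda>x. 0) = 0"
  unfolding sg_energy_level_def by simp

text \<open>The energy of \<open>u\<close> against a harmonic function depends on the corner values of \<open>u\<close> only, at every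
  level: the restriction to a cell is again harmonic, and the factor 5/3 is what makes the
  contributions of the junctions cancel.\<close>

lemma level_harm: "level m u (corner_harmonic k) = 2 * u (q k) - u (q (k + 1)) - u (q (k + 2))"
proof (induction m arbitrary: u k)
  case 0
  show ?case unfolding level_0[of _ _ k] by simp
next
  case (Suc m)
  have "level m (u \<circ> F k) (corner_harmonic k \<circ> F k) = level m (u \<circ> F k) (\<lambda>x. 2/5 + 3/5 * corner_harmonic k x + 0 * corner_harmonic k x)"
    by (rule level_cong) (simp_all add: harm_map harm_step_def)
  then have 1: "level m (u \<circ> F k) (corner_harmonic k \<circ> F k) = 3/5 * level m (u \<circ> F k) (corner_harmonic k)"
    unfolding level_affine by simp
  have 2: "level m (u \<circ> F j) (corner_harmonic k \<circ> F j)
      = 1/5 * level m (u \<circ> F j) (corner_harmonic k) + (- 1/5) * level m (u \<circ> F j) (corner_harmonic j)" if "j \<noteq> k" for j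
  proof -
    have "level m (u \<circ> F j) (corner_harmonic k \<circ> F j)
        = level m (u \<circ> F j) (\<lambda>x. 1/5 + 1/5 * corner_harmonic k x + (- 1/5) * corner_harmonic j x)"
      by (rule level_cong) (use that in \<open>simp_all add: harm_map harm_step_def\<close>)
    then show ?thesis unfolding level_affine .
  qed
  show ?case
    unfolding level_Suc sum_three[of _ k] 1 2[of "k + 1", OF three_distinct(1)] 2[of "k + 2", OF three_distinct(2)] Suc
    by (simp add: sg_map_swap[of q "k + 1" k] sg_map_swap[of q "k + 2" k] sg_map_swap[of q "k + 2" "k + 1"]) argo
qed

text \<open>\<open>junction i\<close> is where the cells \<open>i + 1\<close> and \<open>i + 2\<close> meet.\<close>

definition junction :: "3 \<Rightarrow> real^2" where
  "junction i = F (i + 1) (q (i + 2))"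

lemma map_vertex_junction:
  "F j (q (j + 1)) = junction (j + 2)" "F j (q (j + 2)) = junction (j + 1)"
  "F (j + 1) (q j) = junction (j + 2)" "F (j + 2) (q j) = junction (j + 1)"
  "F (j + 1) (q (j + 2)) = junction j" "F (j + 2) (q (j + 1)) = junction j"
  unfolding junction_def by (simp_all add: sg_map_swap[of q _ j] sg_map_swap[of q "j + 2" "j + 1"])

lemma level_tent:
  "level (Suc m) u (tent i) = 5/3 * (4 * u (junction i) - u (junction (i + 1)) - u (junction (i + 2))
     - u (q (i + 1)) - u (q (i + 2)))"
proof -
  have 0: "level m (u \<circ> F i) (tent i \<circ> F i) = level m (u \<circ> F i) (\<lambda>x. 0)"
    by (rule level_cong) (simp_all add: tent_map tent_part_def)
  have 1: "level m (u \<circ> F (i + 1)) (tent i \<circ> F (i + 1)) = level m (u \<circ> F (i + 1)) (corner_harmonic (i + 2))"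
    by (rule level_cong) (simp_all add: tent_map tent_part_def)
  have 2: "level m (u \<circ> F (i + 2)) (tent i \<circ> F (i + 2)) = level m (u \<circ> F (i + 2)) (corner_harmonic (i + 1))"
    by (rule level_cong) (simp_all add: tent_map tent_part_def)
  have "level (Suc m) u (tent i) = 5/3 * (level m (u \<circ> F i) (\<lambda>x. 0)
      + level m (u \<circ> F (i + 1)) (corner_harmonic (i + 2)) + level m (u \<circ> F (i + 2)) (corner_harmonic (i + 1)))"
    by (simp only: level_Suc sum_three[of _ i] 0 1 2)
  then show ?thesis unfolding level_zero level_harm by (simp add: map_vertex_junction)
qed

lemma level_ext:
  assumes "\<And>j. v (q j) = 0"
  shows "level (length w + m) u (cell_ext w v) = (5/3) ^ length w * level m (u \<circ> W w) v"
proof (induction w arbitrary: u)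
  case (Cons j w)
  have a: "level (length w + m) (u \<circ> F j) (cell_ext (j # w) v \<circ> F j) = level (length w + m) (u \<circ> F j) (cell_ext w v)"
    by (rule level_cong) (simp_all add: ext_map[of v, OF assms] del: cell_ext.simps)
  have b: "level (length w + m) (u \<circ> F i) (cell_ext (j # w) v \<circ> F i) = 0" if "i \<noteq> j" for i
  proof -
    have "level (length w + m) (u \<circ> F i) (cell_ext (j # w) v \<circ> F i) = level (length w + m) (u \<circ> F i) (\<lambda>x. 0)"
      by (rule level_cong) (use that in \<open>simp_all add: ext_map[of v, OF assms] del: cell_ext.simps\<close>)
    then show ?thesis by (simp only: level_zero)
  qed
  have "level (length (j # w) + m) u (cell_ext (j # w) v) = 5/3 * level (length w + m) (u \<circ> F j) (cell_ext w v)"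
    unfolding list.size(4) add_Suc_right add_0_right add_Suc level_Suc sum_three[of _ j] a
      b[of "j + 1", OF three_distinct(1)] b[of "j + 2", OF three_distinct(2)] by simp
  then show ?case unfolding Cons.IH by (simp add: comp_def del: cell_ext.simps)
qed simp

lemma ext_tent_level:
  "level (m + Suc (length w)) u (cell_ext w (tent i)) = (5/3) ^ Suc (length w) *
     (4 * u (W w (junction i)) - u (W w (junction (i + 1))) - u (W w (junction (i + 2)))
     - u (W w (q (i + 1))) - u (W w (q (i + 2))))"
proof -
  have "m + Suc (length w) = length w + Suc m" by simp
  then show ?thesis by (simp only: level_ext[of "tent i", OF tent_vertex] level_tent) simp
qed

lemma level_self_ext_convergent: "convergent (\<lambda>m. level m (cell_ext w (tent i)) (cell_ext w (tent i)))"
proof -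
  have "convergent (\<lambda>m. level (m + Suc (length w)) (cell_ext w (tent i)) (cell_ext w (tent i)))"
    unfolding ext_tent_level by (rule convergent_const)
  then show ?thesis by (subst (asm) convergent_ignore_initial_segment)
qed

lemma ext_tent_dom: "cell_ext w (tent i) \<in> sg_dom_energy q"
  unfolding sg_dom_energy_def
  using continuous_ext[OF tent_vertex continuous_tent] level_self_ext_convergent by blast

text \<open>Testing against the tent of a small cell isolates the graph Laplacian of \<open>u\<close> at one junction.
  No convergence of energies is at issue, since the level energies are constant from the level of
  the tent on.\<close>

lemma energy_ext_tent:
  "sg_energy q u (cell_ext w (tent i)) = (5/3) ^ Suc (length w) *
     (4 * u (W w (junction i)) - u (W w (junction (i + 1))) - u (W w (junction (i + 2)))
     - u (W w (q (i + 1))) - u (W w (q (i + 2))))" (is "_ = ?c")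
proof -
  have "(\<lambda>m. level (m + Suc (length w)) u (cell_ext w (tent i))) \<longlonglongrightarrow> ?c"
    unfolding ext_tent_level by (rule tendsto_const)
  then have "(\<lambda>m. level m u (cell_ext w (tent i))) \<longlonglongrightarrow> ?c" by (rule LIMSEQ_offset)
  then show ?thesis unfolding sg_energy_def by (rule limI)
qed

end

section \<open>The Laplacian tested against tents\<close>

locale gasket_measure = gasket +
  fixes \<mu> :: "(real^2) measure"
  assumes self_similar: "sg_self_similar_measure q \<mu>"
begin

lemma sets_mu: "sets \<mu> = sets (restrict_space borel K)"
  using self_similar unfolding sg_self_similar_measure_def by blast

lemma space_mu: "space \<mu> = K"
  using sets_eq_imp_space_eq[OF sets_mu] by (simp add: space_restrict_space)

sublocale prob_space \<mu>
  using self_similar unfolding sg_self_similar_measure_def by blast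

lemma measure_cell: "measure \<mu> (W w ` K) = (1/3) ^ length w"
  using self_similar unfolding sg_self_similar_measure_def by blast

lemma cell_measurable: "W w ` K \<in> sets \<mu>"
proof -
  have "W w ` K = K \<inter> W w ` K" using cell_subset[of w] by blast
  then show ?thesis unfolding sets_mu sets_restrict_space using borel_closed[OF cell_closed[of w]] by blast
qed

lemma continuous_measurable: "continuous_on K g \<Longrightarrow> g \<in> borel_measurable \<mu>"
  using borel_measurable_continuous_on_restrict[of K g] measurable_cong_sets[OF sets_mu refl] by blast

lemma L2_integrable:
  assumes "f \<in> L2_space \<mu>"
  shows "integrable \<mu> f" "integrable \<mu> (\<lambda>x. (f x)\<^sup>2)" "f \<in> borel_measurable \<mu>"
proof -
  show *: "integrable \<mu> (\<lambda>x. (f x)\<^sup>2)" "f \<in> borel_measurable \<mu>"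
    using assms unfolding L2_space_def by auto
  have "integrable \<mu> (\<lambda>x. 1 + (f x)\<^sup>2)" using * by simp
  then show "integrable \<mu> f"
  proof (rule Bochner_Integration.integrable_bound[OF _ *(2)])
    have "\<bar>a\<bar> \<le> 1 + a\<^sup>2" for a :: real
    proof -
      have "0 \<le> (\<bar>a\<bar> - 1)\<^sup>2" by simp
      then have "2 * \<bar>a\<bar> \<le> 1 + a\<^sup>2" by (simp add: power2_eq_square algebra_simps)
      then show ?thesis by linarith
    qed
    then show "AE x in \<mu>. norm (f x) \<le> norm (1 + (f x)\<^sup>2)" by (auto simp: abs_of_nonneg add_nonneg_nonneg)
  qed
qed

lemma integrable_mult_bounded:
  fixes f g :: "real^2 \<Rightarrow> real"
  assumes "integrable \<mu> f" "g \<in> borel_measurable \<mu>" "\<And>x. x \<in> K \<Longrightarrow> g x \<in> {0..1}"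
  shows "integrable \<mu> (\<lambda>x. f x * g x)"
proof (rule Bochner_Integration.integrable_bound[OF assms(1)])
  show "(\<lambda>x. f x * g x) \<in> borel_measurable \<mu>" using assms(1,2) by simp
  have "norm (f x * g x) \<le> norm (f x)" if "x \<in> space \<mu>" for x
  proof -
    have "g x \<in> {0..1}" using assms(3) that unfolding space_mu .
    then have "\<bar>f x\<bar> * \<bar>g x\<bar> \<le> \<bar>f x\<bar> * 1" by (intro mult_left_mono) auto
    then show ?thesis by (simp add: abs_mult)
  qed
  then show "AE x in \<mu>. norm (f x * g x) \<le> norm (f x)" by (rule AE_I2)
qed

text \<open>Cauchy-Schwarz for the measure with density \<open>g\<close>, from \<open>0 \<le> \<integral>(f - t)\<^sup>2 g\<close> with
  \<open>t = (\<integral> f g) / c\<close>.\<close>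

lemma weighted_cauchy_schwarz:
  fixes f g :: "real^2 \<Rightarrow> real"
  assumes f: "f \<in> L2_space \<mu>" and g: "g \<in> borel_measurable \<mu>" "\<And>x. x \<in> K \<Longrightarrow> g x \<in> {0..1}"
    and c: "0 < c" "(LINT x|\<mu>. g x) \<le> c"
  shows "(LINT x|\<mu>. f x * g x)\<^sup>2 \<le> c * (LINT x|\<mu>. (f x)\<^sup>2 * g x)"
proof -
  define I where "I = (LINT x|\<mu>. f x * g x)"
  define t where "t = I / c"
  note int = integrable_mult_bounded[OF L2_integrable(1)[OF f] g]
    integrable_mult_bounded[OF L2_integrable(2)[OF f] g]
    integrable_mult_bounded[OF _ g, of "\<lambda>x. 1"]
  have "0 \<le> (LINT x|\<mu>. (f x - t)\<^sup>2 * g x)"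
  proof (intro integral_nonneg_AE AE_I2)
    fix x assume "x \<in> space \<mu>"
    then have "g x \<in> {0..1}" using g(2) unfolding space_mu by blast
    then show "0 \<le> (f x - t)\<^sup>2 * g x" by simp
  qed
  also have "\<dots> = (LINT x|\<mu>. (f x)\<^sup>2 * g x - 2 * t * (f x * g x) + t\<^sup>2 * (1 * g x))"
    by (intro Bochner_Integration.integral_cong refl) (simp add: power2_eq_square algebra_simps)
  also have "\<dots> = (LINT x|\<mu>. (f x)\<^sup>2 * g x) - 2 * t * I + t\<^sup>2 * (LINT x|\<mu>. g x)"
    using int unfolding I_def by simp
  also have "\<dots> \<le> (LINT x|\<mu>. (f x)\<^sup>2 * g x) - 2 * t * I + t\<^sup>2 * c"
    using c(2) by (simp add: mult_left_mono)
  also have "\<dots> = (LINT x|\<mu>. (f x)\<^sup>2 * g x) - I\<^sup>2 / c"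
    using c(1) unfolding t_def by (simp add: power2_eq_square field_simps)
  finally show ?thesis unfolding I_def[symmetric] using c(1) by (simp add: field_simps)
qed

abbreviation cell_tent :: "3 list \<Rightarrow> 3 \<Rightarrow> real^2 \<Rightarrow> real" where
  "cell_tent w i \<equiv> cell_ext w (tent i)"

lemma cell_tent_range: "x \<in> K \<Longrightarrow> cell_tent w i x \<in> {0..1}"
  by (rule ext_bounds[of "tent i", OF tent_vertex tent_bounds])

lemma cell_tent_measurable: "cell_tent w i \<in> borel_measurable \<mu>"
  by (rule continuous_measurable[OF continuous_ext[of "tent i", OF tent_vertex continuous_tent]])

lemma cell_tent_le_indicator:
  assumes "x \<in> K" shows "cell_tent (v @ w) i x \<le> indicator (W v ` K) x"
proof (cases "x \<in> W v ` K")
  case False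
  then have "x \<notin> W (v @ w) ` K" by (auto simp: word_append)
  then show ?thesis using ext_outside[of "tent i", OF tent_vertex assms] by (simp add: indicator_def)
next
  case True
  then show ?thesis using cell_tent_range[OF assms, of "v @ w" i] by simp
qed

lemma integrable_cell_tent: "integrable \<mu> (cell_tent w i)"
  using integrable_mult_bounded[OF _ cell_tent_measurable cell_tent_range, of "\<lambda>x. 1"] by simp

lemma integral_cell_tent: "(LINT x|\<mu>. cell_tent w i x) \<le> (1/3) ^ length w"
proof -
  have c: "W w ` K \<inter> space \<mu> = W w ` K" using cell_subset[of w] space_mu by blast
  have "integrable \<mu> (indicator (W w ` K) :: _ \<Rightarrow> real)"
    using cell_measurable[of w] by (simp add: integrable_indicator_iff c emeasure_finite less_top[symmetric])
  then have "(LINT x|\<mu>. cell_tent w i x) \<le> (LINT x|\<mu>. indicator (W w ` K) x)"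
    using cell_tent_le_indicator[of _ w "[]" i] by (intro integral_mono integrable_cell_tent) (auto simp: space_mu)
  also have "\<dots> = measure \<mu> (W w ` K)" by (simp only: Bochner_Integration.integral_indicator c)
  finally show ?thesis by (simp only: measure_cell)
qed

definition tent_sum :: "nat \<Rightarrow> real^2 \<Rightarrow> real" where
  "tent_sum N x = (\<Sum>n<N. \<Sum>i\<in>UNIV. cell_tent (replicate n 0) i x)"

text \<open>The tents at all scales around a corner overlap boundedly, since the tents of one scale
  decay geometrically towards the corner; the right-hand side is the fixed point of the
  recursion that passing from \<open>N\<close> to \<open>Suc N\<close> imposes.\<close>

lemma tent_sum_le: "x \<in> K \<Longrightarrow> tent_sum N x \<le> 1 + 5/2 * corner_harmonic 0 x"
proof (induction N arbitrary: x)
  case 0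
  then show ?case using harm_nonneg[of x 0] by (simp add: tent_sum_def)
next
  case (Suc N)
  show ?case using Suc.prems
  proof (rule SG_induct_step[rotated])
    fix j y assume y: "y \<in> K"
    have "(\<Sum>i\<in>UNIV. tent i (F j y)) = corner_harmonic (j + 2) y + corner_harmonic (j + 1) y"
      unfolding sum_three[of _ j] tent_map[OF y] tent_part_def by simp
    also have "\<dots> = 1 - corner_harmonic j y" using harm_sum[OF y, of j] by simp
    finally have T: "(\<Sum>i\<in>UNIV. tent i (F j y)) = 1 - corner_harmonic j y" .
    have e: "cell_tent (0 # w) i (F j y) = (if j = 0 then cell_tent w i y else 0)" for w i
      by (rule ext_map[of "tent i", OF tent_vertex y])
    have "tent_sum (Suc N) (F j y)
        = (\<Sum>i\<in>UNIV. tent i (F j y)) + (\<Sum>n<N. \<Sum>i\<in>UNIV. cell_tent (0 # replicate n 0) i (F j y))"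
      unfolding tent_sum_def by (subst sum.lessThan_Suc_shift) simp
    then have rec: "tent_sum (Suc N) (F j y) = 1 - corner_harmonic j y + (if j = 0 then tent_sum N y else 0)"
      unfolding T e tent_sum_def by simp
    show "tent_sum (Suc N) (F j y) \<le> 1 + 5/2 * corner_harmonic 0 (F j y)"
    proof (cases "j = 0")
      case True
      then show ?thesis using Suc.IH[OF y] unfolding rec harm_map[OF y] harm_step_def by simp
    next
      case False
      then show ?thesis using harm_nonneg[OF y, of 0] harm_nonneg[OF y, of j]
        unfolding rec harm_map[OF y] harm_step_def by (simp add: field_simps)
    qed
  qed
qed

lemma integral_tent_sum:
  assumes f: "f \<in> L2_space \<mu>"
  shows "(\<Sum>n<N. \<Sum>i\<in>UNIV. LINT x|\<mu>. (f x)\<^sup>2 * cell_tent (replicate n 0) i x) \<le> 7/2 * (LINT x|\<mu>. (f x)\<^sup>2)"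
proof -
  note int = integrable_mult_bounded[OF L2_integrable(2)[OF f] cell_tent_measurable cell_tent_range]
  have "(\<Sum>n<N. \<Sum>i\<in>UNIV. LINT x|\<mu>. (f x)\<^sup>2 * cell_tent (replicate n 0) i x)
      = (LINT x|\<mu>. (\<Sum>n<N. \<Sum>i\<in>UNIV. (f x)\<^sup>2 * cell_tent (replicate n 0) i x))"
    using int by (simp add: Bochner_Integration.integral_sum)
  also have "\<dots> \<le> (LINT x|\<mu>. 7/2 * (f x)\<^sup>2)"
  proof (rule integral_mono)
    show "integrable \<mu> (\<lambda>x. \<Sum>n<N. \<Sum>i\<in>UNIV. (f x)\<^sup>2 * cell_tent (replicate n 0) i x)"
      using int by (intro Bochner_Integration.integrable_sum)
    show "integrable \<mu> (\<lambda>x. 7/2 * (f x)\<^sup>2)" using L2_integrable(2)[OF f] by simp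
    fix x assume "x \<in> space \<mu>"
    then have x: "x \<in> K" by (simp add: space_mu)
    have "tent_sum N x \<le> 7/2" using tent_sum_le[OF x, of N] harm_le_1[OF x, of 0] by linarith
    then have "(f x)\<^sup>2 * tent_sum N x \<le> (f x)\<^sup>2 * (7/2)" by (intro mult_left_mono) auto
    then show "(\<Sum>n<N. \<Sum>i\<in>UNIV. (f x)\<^sup>2 * cell_tent (replicate n 0) i x) \<le> 7/2 * (f x)\<^sup>2"
      unfolding tent_sum_def by (simp add: sum_distrib_left mult.commute)
  qed
  finally show ?thesis by simp
qed

abbreviation side_cell :: "nat \<Rightarrow> (real^2) set" where
  "side_cell n \<equiv> W (replicate n 0 @ [1]) ` K"

text \<open>The bound is 2 and not 1 since consecutive side cells share a vertex.\<close>

lemma side_cell_overlap: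
  assumes "x \<in> K" shows "(\<Sum>n<N. indicator (side_cell n) x) \<le> (2::real)"
  using assms
proof (induction N arbitrary: x)
  case (Suc N)
  have shift: "indicator (side_cell (Suc n)) (F j y) = (if j = 0 then indicator (side_cell n) y else (0::real))"
    if "y \<in> K" "F j y \<notin> F 1 ` K" for j y n
  proof -
    have "F j y \<in> side_cell (Suc n) \<longleftrightarrow> (\<exists>z\<in>K. F j y = F 0 (W (replicate n 0 @ [1]) z))"
      by (auto simp: image_iff)
    also have "\<dots> \<longleftrightarrow> j = 0 \<and> y \<in> side_cell n"
    proof (cases "j = 0")
      case False
      have "F j y \<noteq> F 0 (W (replicate n 0 @ [1]) z)" if z: "z \<in> K" for z
      proof
        assume e: "F j y = F 0 (W (replicate n 0 @ [1]) z)"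
        have s: "j = 2" using False that \<open>F j y \<notin> F 1 ` K\<close> \<open>y \<in> K\<close> exhaust_3[of j] by auto
        then have "W (replicate n 0 @ [1]) z = q 2"
          using map_eq_iff[OF \<open>y \<in> K\<close> word_in_SG[OF z], of j 0] e by simp
        moreover have "W (replicate n 0 @ [1]) z \<noteq> q 2"
          using vertex_eq_map_iff[of _ _ 2] z by (cases n) auto
        ultimately show False by blast
      qed
      then show ?thesis using False by blast
    qed (auto simp: image_iff)
    finally show ?thesis by (simp add: indicator_def)
  qed
  have step: "(\<Sum>n<Suc N. indicator (side_cell n) x)
      = (indicator (F 1 ` K) x :: real) + (\<Sum>n<N. indicator (side_cell (Suc n)) x)"
    by (subst sum.lessThan_Suc_shift) (simp add: image_comp)
  obtain j y where y: "y \<in> K" "x = F j y" using SG_cases[OF Suc.prems] by metis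
  show ?case
  proof (cases "x \<in> F 1 ` K")
    case False
    then have "(\<Sum>n<N. indicator (side_cell (Suc n)) x) = (if j = 0 then \<Sum>n<N. indicator (side_cell n) y else (0::real))"
      using shift[OF y(1), of j] y(2) by simp
    then show ?thesis using step False Suc.IH[OF y(1)] by (simp add: indicator_def split: if_splits)
  next
    case True
    then obtain z where z: "z \<in> K" "x = F 1 z" by auto
    have "indicator (side_cell (Suc n)) x = (0::real)" if "n \<noteq> 0" for n
    proof -
      have "x \<notin> side_cell (Suc n)"
      proof
        assume "x \<in> side_cell (Suc n)"
        then obtain s where s: "s \<in> K" "F 1 z = F 0 (W (replicate n 0 @ [1]) s)" using z(2) by auto
        then have "W (replicate n 0 @ [1]) s = q 1"
          using map_eq_iff[OF z(1) word_in_SG[OF s(1)], of 1 0] by simp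
        then show False using that s(1) vertex_eq_map_iff[of _ 0 1] by (cases n) auto
      qed
      then show ?thesis by simp
    qed
    then have "(\<Sum>n<N. indicator (side_cell (Suc n)) x) \<le> (\<Sum>n<N. if n = 0 then 1 else (0::real))"
      by (intro sum_mono) (simp add: indicator_def)
    also have "\<dots> \<le> 1" by simp
    finally show ?thesis using step True by simp
  qed
qed simp

lemma integral_side_cells:
  assumes f: "f \<in> L2_space \<mu>"
  shows "(\<Sum>n<N. LINT x|\<mu>. (f x)\<^sup>2 * indicator (side_cell n) x) \<le> 2 * (LINT x|\<mu>. (f x)\<^sup>2)"
proof -
  have int: "integrable \<mu> (\<lambda>x. (f x)\<^sup>2 * indicator (side_cell n) x)" for n
    using cell_measurable by (intro integrable_mult_bounded L2_integrable(2)[OF f] borel_measurable_indicator)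
      (auto simp: indicator_def)
  have "(\<Sum>n<N. LINT x|\<mu>. (f x)\<^sup>2 * indicator (side_cell n) x)
      = (LINT x|\<mu>. (\<Sum>n<N. (f x)\<^sup>2 * indicator (side_cell n) x))"
    by (rule Bochner_Integration.integral_sum[symmetric]) (rule int)
  also have "\<dots> \<le> (LINT x|\<mu>. 2 * (f x)\<^sup>2)"
  proof (rule integral_mono)
    show "integrable \<mu> (\<lambda>x. \<Sum>n<N. (f x)\<^sup>2 * indicator (side_cell n) x)"
      using int by (intro Bochner_Integration.integrable_sum)
    show "integrable \<mu> (\<lambda>x. 2 * (f x)\<^sup>2)" using L2_integrable(2)[OF f] by simp
    fix x assume "x \<in> space \<mu>"
    then have x: "x \<in> K" by (simp add: space_mu)
    have "(f x)\<^sup>2 * (\<Sum>n<N. indicator (side_cell n) x) \<le> (f x)\<^sup>2 * 2"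
      by (intro mult_left_mono side_cell_overlap x) auto
    then show "(\<Sum>n<N. (f x)\<^sup>2 * indicator (side_cell n) x) \<le> 2 * (f x)\<^sup>2"
      by (simp add: sum_distrib_left mult.commute)
  qed
  finally show ?thesis by simp
qed

end

section \<open>Local equations for weak solutions\<close>

locale weak_solution = gasket_measure +
  fixes u f :: "real^2 \<Rightarrow> real"
  assumes f_L2: "f \<in> L2_space \<mu>" and weak: "sg_weak_laplacian q \<mu> u f"
begin

text \<open>The source term that the tent at junction \<open>i\<close> of the cell \<open>w\<close> sees.\<close>

definition load :: "3 list \<Rightarrow> 3 \<Rightarrow> real" where
  "load w i = (LINT x|\<mu>. f x * cell_tent w i x)"

definition f_sq :: real where
  "f_sq = (LINT x|\<mu>. (f x)\<^sup>2)"

lemma f_sq_nonneg: "0 \<le> f_sq"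
  unfolding f_sq_def by simp

lemma load_sq: "(load w i)\<^sup>2 \<le> (1/3) ^ length w * (LINT x|\<mu>. (f x)\<^sup>2 * cell_tent w i x)"
  unfolding load_def
  by (rule weighted_cauchy_schwarz[OF f_L2 cell_tent_measurable cell_tent_range _ integral_cell_tent]) simp_all

text \<open>A tent inside the cell \<open>v\<close> sees only the mass of \<open>f\<^sup>2\<close> in that cell. For the side cells these
  masses are summable, which controls the tails of the normal derivatives.\<close>

lemma load_sq_subcell:
  "(load (v @ w) i)\<^sup>2 \<le> (1/3) ^ (length v + length w) * (LINT x|\<mu>. (f x)\<^sup>2 * indicator (W v ` K) x)"
proof -
  have "(LINT x|\<mu>. (f x)\<^sup>2 * cell_tent (v @ w) i x) \<le> (LINT x|\<mu>. (f x)\<^sup>2 * indicator (W v ` K) x)"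
  proof (rule integral_mono)
    show "integrable \<mu> (\<lambda>x. (f x)\<^sup>2 * cell_tent (v @ w) i x)"
      by (rule integrable_mult_bounded[OF L2_integrable(2)[OF f_L2] cell_tent_measurable cell_tent_range])
    show "integrable \<mu> (\<lambda>x. (f x)\<^sup>2 * indicator (W v ` K) x)"
      using cell_measurable[of v]
      by (intro integrable_mult_bounded L2_integrable(2)[OF f_L2] borel_measurable_indicator)
        (auto simp: indicator_def)
  qed (intro mult_left_mono cell_tent_le_indicator, simp_all add: space_mu)
  then have "(1/3) ^ length (v @ w) * (LINT x|\<mu>. (f x)\<^sup>2 * cell_tent (v @ w) i x)
      \<le> (1/3) ^ length (v @ w) * (LINT x|\<mu>. (f x)\<^sup>2 * indicator (W v ` K) x)"
    by (rule mult_left_mono) simp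
  then show ?thesis using load_sq[of "v @ w" i] unfolding length_append by linarith
qed

lemma load_sq_le: "(load w i)\<^sup>2 \<le> (1/3) ^ length w * f_sq"
proof -
  have "(LINT x|\<mu>. (f x)\<^sup>2 * indicator K x) = f_sq"
    unfolding f_sq_def
    by (rule Bochner_Integration.integral_cong) (simp_all add: space_mu)
  then show ?thesis using load_sq_subcell[of "[]" w i] by simp
qed

lemma load_bound:
  assumes "AE x in \<mu>. \<bar>f x\<bar> \<le> A" "0 \<le> A"
  shows "\<bar>load w i\<bar> \<le> A * (1/3) ^ length w"
proof -
  have int: "integrable \<mu> (\<lambda>x. f x * cell_tent w i x)"
    by (rule integrable_mult_bounded[OF L2_integrable(1)[OF f_L2] cell_tent_measurable cell_tent_range])
  have "\<bar>load w i\<bar> \<le> (LINT x|\<mu>. \<bar>f x * cell_tent w i x\<bar>)"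
    unfolding load_def by (rule integral_abs_bound)
  also have "\<dots> \<le> (LINT x|\<mu>. A * cell_tent w i x)"
  proof (rule integral_mono_AE)
    show "integrable \<mu> (\<lambda>x. \<bar>f x * cell_tent w i x\<bar>)" using int by (rule integrable_abs)
    show "integrable \<mu> (\<lambda>x. A * cell_tent w i x)" using integrable_cell_tent by simp
    show "AE x in \<mu>. \<bar>f x * cell_tent w i x\<bar> \<le> A * cell_tent w i x"
      using assms(1)
    proof (rule AE_mp, intro AE_I2 impI)
      fix x assume "x \<in> space \<mu>" and *: "\<bar>f x\<bar> \<le> A"
      then have "cell_tent w i x \<in> {0..1}" using cell_tent_range unfolding space_mu by blast
      then show "\<bar>f x * cell_tent w i x\<bar> \<le> A * cell_tent w i x"
        using mult_right_mono[OF *, of "cell_tent w i x"] by (simp add: abs_mult)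
    qed
  qed
  also have "\<dots> = A * (LINT x|\<mu>. cell_tent w i x)" by simp
  also have "\<dots> \<le> A * (1/3) ^ length w" by (rule mult_left_mono[OF integral_cell_tent assms(2)])
  finally show ?thesis .
qed

text \<open>Loads enter the equations for the values of \<open>u\<close> divided by the factor that scales the energy
  of a tent.\<close>

definition err :: "3 list \<Rightarrow> 3 \<Rightarrow> real" where
  "err w i = (3/5) ^ Suc (length w) * load w i"

lemma tent_equation:
  "4 * u (W w (junction i)) - u (W w (junction (i + 1))) - u (W w (junction (i + 2)))
     - u (W w (q (i + 1))) - u (W w (q (i + 2))) = - err w i" (is "?e = _")
proof -
  have "sg_energy q u (cell_tent w i) = - load w i"
    using weak ext_tent_dom ext_vertex[of "tent i", OF tent_vertex]
    unfolding sg_weak_laplacian_def load_def by auto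
  then have "(5/3) ^ Suc (length w) * ?e = - load w i" unfolding energy_ext_tent .
  then have "(3/5) ^ Suc (length w) * ((5/3) ^ Suc (length w) * ?e) = - err w i"
    unfolding err_def by simp
  then show ?thesis unfolding mult.assoc[symmetric] power_mult_distrib[symmetric] by simp
qed

text \<open>Solving the three tent equations of a cell perturbs the 1/5-2/5 rule by the loads.\<close>

lemma junction_value:
  "5 * u (W w (junction i)) = u (W w (q i)) + 2 * u (W w (q (i + 1))) + 2 * u (W w (q (i + 2)))
     - (3 * err w i + err w (i + 1) + err w (i + 2)) / 2"
proof -
  have solve: "5 * x = a + 2 * b + 2 * c - (3 * r + s + t) / 2"
    if "4 * x - y - z - b - c = - r" "4 * y - z - x - c - a = - s" "4 * z - x - y - a - b = - t"
    for a b c r s t x y z :: real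
    using that by argo
  show ?thesis
    by (rule solve[OF tent_equation tent_equation[of w "i + 1", unfolded three_add]
        tent_equation[of w "i + 2", unfolded three_add]])
qed

lemma junction_values_012:
  "5 * u (W w (junction 0)) = u (W w (q 0)) + 2 * u (W w (q 1)) + 2 * u (W w (q 2))
     - (3 * err w 0 + err w 1 + err w 2) / 2"
  "5 * u (W w (junction 1)) = u (W w (q 1)) + 2 * u (W w (q 2)) + 2 * u (W w (q 0))
     - (3 * err w 1 + err w 2 + err w 0) / 2"
  "5 * u (W w (junction 2)) = u (W w (q 2)) + 2 * u (W w (q 0)) + 2 * u (W w (q 1))
     - (3 * err w 2 + err w 0 + err w 1) / 2"
  using junction_value[of w 0] junction_value[of w 1] junction_value[of w "2"]
  unfolding three_values by blast+

subsection \<open>The quotients defining a normal derivative\<close>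

lemma word_corner: "W (replicate k j) (q j) = q j"
  by (induction k) auto

lemma word_snoc_vertex:
  "W (w @ replicate (Suc k) j) (q (j + 1)) = W (w @ replicate k j) (junction (j + 2))"
  "W (w @ replicate (Suc k) j) (q (j + 2)) = W (w @ replicate k j) (junction (j + 1))"
  "W (w @ replicate k j) (q j) = W w (q j)"
proof -
  have "W (w @ replicate (Suc k) j) x = W (w @ replicate k j) (F j x)" for x
    by (simp add: word_append replicate_append_same[symmetric] del: replicate_append_same)
  then show "W (w @ replicate (Suc k) j) (q (j + 1)) = W (w @ replicate k j) (junction (j + 2))"
    "W (w @ replicate (Suc k) j) (q (j + 2)) = W (w @ replicate k j) (junction (j + 1))"
    by (simp_all only: map_vertex_junction)
  show "W (w @ replicate k j) (q j) = W w (q j)" by (simp add: word_append word_corner)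
qed

lemma quotient_eq:
  "normal_quotient q u w j k = (5/3) ^ (length w + k) *
     (2 * u (W w (q j)) - u (W (w @ replicate k j) (q (j + 1))) - u (W (w @ replicate k j) (q (j + 2))))"
  unfolding normal_quotient_def by (simp add: word_append word_replicate)

text \<open>For harmonic functions the quotients do not depend on \<open>k\<close>, by the 1/5-2/5 rule; hence only the
  loads of the cells shrinking to the corner move them.\<close>

lemma quotient_Suc:
  "normal_quotient q u w j (Suc k) = normal_quotient q u w j k +
     (load (w @ replicate k j) j + 2 * load (w @ replicate k j) (j + 1) + 2 * load (w @ replicate k j) (j + 2)) / 5"
proof -
  let ?w = "w @ replicate k j"
  have 1: "5 * u (W ?w (junction (j + 2))) = u (W ?w (q (j + 2))) + 2 * u (W w (q j)) + 2 * u (W ?w (q (j + 1)))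
     - (3 * err ?w (j + 2) + err ?w j + err ?w (j + 1)) / 2"
    using junction_value[of ?w "j + 2"] unfolding three_add word_snoc_vertex(3) .
  have 2: "5 * u (W ?w (junction (j + 1))) = u (W ?w (q (j + 1))) + 2 * u (W ?w (q (j + 2))) + 2 * u (W w (q j))
     - (3 * err ?w (j + 1) + err ?w (j + 2) + err ?w j) / 2"
    using junction_value[of ?w "j + 1"] unfolding three_add word_snoc_vertex(3) .
  define c where "c = (5/3::real) ^ Suc (length w + k)"
  have c: "c * err ?w i = load ?w i" for i
    unfolding c_def err_def mult.assoc[symmetric] length_append length_replicate
      power_mult_distrib[symmetric] by simp
  have c0: "(5/3) ^ (length w + k) = 3/5 * c" unfolding c_def by simp
  have "normal_quotient q u w j (Suc k)
      = c * (2 * u (W w (q j)) - u (W ?w (junction (j + 2))) - u (W ?w (junction (j + 1))))"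
    unfolding quotient_eq word_snoc_vertex c_def by simp
  also have "\<dots> = c * (3/5 * (2 * u (W w (q j)) - u (W ?w (q (j + 1))) - u (W ?w (q (j + 2))))
      + (err ?w j + 2 * err ?w (j + 1) + 2 * err ?w (j + 2)) / 5)"
    by (rule arg_cong[of _ _ "\<lambda>t. c * t"]) (use 1 2 in argo)
  also have "\<dots> = 3/5 * c * (2 * u (W w (q j)) - u (W ?w (q (j + 1))) - u (W ?w (q (j + 2))))
      + (c * err ?w j + 2 * (c * err ?w (j + 1)) + 2 * (c * err ?w (j + 2))) / 5"
    by (simp add: algebra_simps)
  finally show ?thesis unfolding c quotient_eq c0 by simp
qed

lemma load_summable: "summable (\<lambda>k. load (w @ replicate k j) i)"
  and load_sqrt_bound: "\<bar>load w i\<bar> \<le> sqrt f_sq * sqrt (1/3) ^ length w"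
proof -
  have *: "\<bar>load w i\<bar> \<le> sqrt f_sq * sqrt (1/3) ^ length w" for w i
    using real_sqrt_le_mono[OF load_sq_le[of w i]]
    by (simp only: real_sqrt_abs) (simp only: real_sqrt_mult real_sqrt_power mult.commute)
  then show "\<bar>load w i\<bar> \<le> sqrt f_sq * sqrt (1/3) ^ length w" .
  show "summable (\<lambda>k. load (w @ replicate k j) i)"
  proof (rule summable_comparison_test')
    have "sqrt (1/3) < (1::real)" by simp
    then show "summable (\<lambda>k. sqrt f_sq * sqrt (1/3) ^ length w * sqrt (1/3) ^ k)"
      by (intro summable_mult summable_geometric) simp
    show "norm (load (w @ replicate k j) i) \<le> sqrt f_sq * sqrt (1/3) ^ length w * sqrt (1/3) ^ k" if "k \<ge> 0" for k
      using *[of "w @ replicate k j" i] by (simp add: power_add mult.assoc)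
  qed
qed

definition load_tail :: "3 list \<Rightarrow> 3 \<Rightarrow> real" where
  "load_tail w j = (\<Sum>k. (load (w @ replicate k j) j + 2 * load (w @ replicate k j) (j + 1)
      + 2 * load (w @ replicate k j) (j + 2)) / 5)"

lemma quotient_limit:
  "normal_quotient q u w j \<longlonglongrightarrow> normal_quotient q u w j 0 + load_tail w j"
proof -
  define g where "g k = (load (w @ replicate k j) j + 2 * load (w @ replicate k j) (j + 1)
      + 2 * load (w @ replicate k j) (j + 2)) / 5" for k
  have "normal_quotient q u w j k = normal_quotient q u w j 0 + (\<Sum>i<k. g i)" for k
  proof (induction k)
    case (Suc k)
    then show ?case unfolding quotient_Suc sum.lessThan_Suc by (simp add: g_def)
  qed simp
  then have eq: "(\<lambda>k. normal_quotient q u w j 0 + (\<Sum>i<k. g i)) = normal_quotient q u w j"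
    by (intro HOL.ext) (rule sym)
  have "summable g"
    unfolding g_def by (intro summable_divide summable_add summable_mult load_summable)
  then have "(\<lambda>k. normal_quotient q u w j 0 + (\<Sum>i<k. g i))
      \<longlonglongrightarrow> normal_quotient q u w j 0 + suminf g"
    by (intro tendsto_add tendsto_const summable_LIMSEQ)
  then show ?thesis unfolding load_tail_def g_def[symmetric] eq .
qed

lemma quotient_convergent: "convergent (normal_quotient q u w j)"
  using quotient_limit convergentI by blast

lemma normal_deriv_eq: "normal_deriv q u w j = normal_quotient q u w j 0 + load_tail w j"
  unfolding normal_deriv_def using quotient_limit by (rule limI)

subsection \<open>The trace on the symmetry line\<close>

abbreviation apex_word :: "nat \<Rightarrow> 3 list" where
  "apex_word n \<equiv> replicate n 0"

text \<open>The part of \<open>u\<close> on the cell of \<open>apex_word n\<close> that is antisymmetric about the symmetry line,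
  scaled like a normal derivative. The values on the line do not see it; it is the main part of the
  normal derivatives there.\<close>

definition skew :: "nat \<Rightarrow> real" where
  "skew n = (5/3) ^ n * (u (W (apex_word n) (q 1)) - u (W (apex_word n) (q 2)))"

lemma err_load: "(5/3) ^ Suc n * err (apex_word n) i = load (apex_word n) i"
  unfolding err_def mult.assoc[symmetric] length_replicate power_mult_distrib[symmetric] by simp

text \<open>Antisymmetric harmonic functions shrink by 1/5 from one cell to the next, and 5/3 times 1/5
  is 1/3.\<close>

lemma skew_Suc:
  "skew (Suc n) = skew n / 3 + (load (apex_word n) 1 - load (apex_word n) 2) / 5"
proof -
  let ?w = "apex_word n"
  have "5 * u (W ?w (junction 2)) = u (W ?w (q 2)) + 2 * u (q 0) + 2 * u (W ?w (q 1))
     - (3 * err ?w 2 + err ?w 0 + err ?w 1) / 2"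
    using junction_values_012[of ?w] by (simp add: word_corner)
  moreover have "5 * u (W ?w (junction 1)) = u (W ?w (q 1)) + 2 * u (W ?w (q 2)) + 2 * u (q 0)
     - (3 * err ?w 1 + err ?w 2 + err ?w 0) / 2"
    using junction_values_012[of ?w] by (simp add: word_corner)
  ultimately have d: "u (W ?w (junction 2)) - u (W ?w (junction 1))
      = (u (W ?w (q 1)) - u (W ?w (q 2))) / 5 + (err ?w 1 - err ?w 2) / 5" by argo
  have "skew (Suc n) = (5/3) ^ Suc n * (u (W ?w (junction 2)) - u (W ?w (junction 1)))"
    using word_snoc_vertex(1,2)[of "[]" n 0] unfolding skew_def by simp
  also have "\<dots> = skew n / 3 + ((5/3) ^ Suc n * err ?w 1 - (5/3) ^ Suc n * err ?w 2) / 5"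
    unfolding d skew_def by (simp add: field_simps)
  finally show ?thesis unfolding err_load .
qed

lemma X_point_word: "X_point q (Suc n) = W (apex_word n) (junction 0)"
  unfolding X_point_def junction_def by (simp add: word_replicate sg_map_swap[of q 2 1])

text \<open>The symmetric harmonic part shrinks by 3/5 from one cell to the next and is carried by the quotient
  at \<open>q 0\<close>, whose limit therefore gives the coefficient of \<open>(3/5)^m\<close>.\<close>

lemma trace_value:
  "u (X_point q (Suc n)) = u (q 0) - 2/5 * (3/5) ^ n * normal_quotient q u [] 0 n
     - (3/5) ^ Suc n * (3 * load (apex_word n) 0 + load (apex_word n) 1 + load (apex_word n) 2) / 10"
proof -
  let ?w = "apex_word n"
  have "5 * u (W ?w (junction 0)) = u (q 0) + 2 * u (W ?w (q 1)) + 2 * u (W ?w (q 2))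
     - (3 * err ?w 0 + err ?w 1 + err ?w 2) / 2"
    using junction_values_012[of ?w] by (simp add: word_corner)
  moreover have "(3/5) ^ n * normal_quotient q u [] 0 n = 2 * u (q 0) - u (W ?w (q 1)) - u (W ?w (q 2))"
  proof -
    have "(3/5::real) ^ n * (5/3) ^ n = 1" unfolding power_mult_distrib[symmetric] by simp
    then show ?thesis unfolding quotient_eq by (simp flip: mult.assoc)
  qed
  ultimately show ?thesis
    unfolding X_point_word err_def length_replicate by (simp add: algebra_simps) argo
qed

text \<open>The first two terms are the quotient for \<open>k = 0\<close>, expressed through the corner values of the
  cell of \<open>apex_word n\<close>; the last one is what the limit adds.\<close>

lemma trace_normal_derivative:
  "normal_deriv q u (Y_word (Suc n)) 2 = - skew n
     - (5 * load (apex_word n) 0 + load (apex_word n) 1 - load (apex_word n) 2) / 10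
     + load_tail (apex_word n @ [1]) 2"
proof -
  let ?w = "apex_word n"
  have j: "W (?w @ [1]) (q 2) = W ?w (junction 0)" "W (?w @ [1]) (q 0) = W ?w (junction 2)"
    "W (?w @ [1]) (q 1) = W ?w (q 1)"
    using map_vertex_junction[of 0] by (simp_all add: word_append)
  have "5 * u (W ?w (junction 0)) = u (q 0) + 2 * u (W ?w (q 1)) + 2 * u (W ?w (q 2))
     - (3 * err ?w 0 + err ?w 1 + err ?w 2) / 2"
    using junction_values_012[of ?w] by (simp add: word_corner)
  moreover have "5 * u (W ?w (junction 2)) = u (W ?w (q 2)) + 2 * u (q 0) + 2 * u (W ?w (q 1))
     - (3 * err ?w 2 + err ?w 0 + err ?w 1) / 2"
    using junction_values_012[of ?w] by (simp add: word_corner)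
  ultimately have e: "2 * u (W ?w (junction 0)) - u (W ?w (junction 2)) - u (W ?w (q 1))
     = - 3/5 * (u (W ?w (q 1)) - u (W ?w (q 2))) - (5 * err ?w 0 + err ?w 1 - err ?w 2) / 10" by argo
  have "normal_quotient q u (?w @ [1]) 2 0
     = (5/3) ^ Suc n * (2 * u (W ?w (junction 0)) - u (W ?w (junction 2)) - u (W ?w (q 1)))"
    using quotient_eq[of "?w @ [1]" 2 0] unfolding three_values by (simp add: j)
  also have "\<dots> = - skew n - (5 * ((5/3) ^ Suc n * err ?w 0) + (5/3) ^ Suc n * err ?w 1
      - (5/3) ^ Suc n * err ?w 2) / 10"
    unfolding e skew_def by (simp add: field_simps)
  finally show ?thesis unfolding normal_deriv_eq err_load Y_word_def by simp
qed

end

section \<open>Sequences with controlled increments\<close>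

lemma geometric_increments:
  fixes x :: "nat \<Rightarrow> real"
  assumes inc: "\<And>n. \<bar>x (Suc n) - x n\<bar> \<le> B * r ^ n" and r: "0 \<le> r" "r < 1"
  obtains l where "x \<longlonglongrightarrow> l" "\<And>n. \<bar>l - x n\<bar> \<le> B * r ^ n / (1 - r)"
proof -
  define g where "g n = x (Suc n) - x n" for n
  have g: "summable g"
    by (rule summable_comparison_test'[where g = "\<lambda>n. B * r ^ n"])
      (use inc r in \<open>auto simp: g_def intro!: summable_mult summable_geometric\<close>)
  have x: "x (n + k) = x n + (\<Sum>i<k. g (i + n))" for n k
    by (induction k) (simp_all add: g_def add.commute)
  have gn: "summable (\<lambda>i. g (i + n))" for n using g by (rule summable_ignore_initial_segment)
  have lim: "x \<longlonglongrightarrow> x n + (\<Sum>i. g (i + n))" for n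
  proof -
    have "(\<lambda>k. x n + (\<Sum>i<k. g (i + n))) \<longlonglongrightarrow> x n + (\<Sum>i. g (i + n))"
      by (intro tendsto_add tendsto_const summable_LIMSEQ gn)
    then have "(\<lambda>k. x (k + n)) \<longlonglongrightarrow> x n + (\<Sum>i. g (i + n))"
      unfolding x[symmetric] by (simp add: add.commute)
    then show ?thesis by (rule LIMSEQ_offset)
  qed
  show ?thesis
  proof
    show "x \<longlonglongrightarrow> x 0 + (\<Sum>i. g (i + 0))" by (rule lim)
    fix n
    have s: "(\<lambda>i. B * r ^ (i + n)) sums (B * r ^ n / (1 - r))"
      using sums_mult[OF geometric_sums[of r], of "B * r ^ n"] r
      by (simp add: power_add mult_ac)
    have "x 0 + (\<Sum>i. g (i + 0)) = x n + (\<Sum>i. g (i + n))"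
      by (rule LIMSEQ_unique[OF lim lim])
    then have "\<bar>x 0 + (\<Sum>i. g (i + 0)) - x n\<bar> = norm (\<Sum>i. g (i + n))" by simp
    also have "\<dots> \<le> (\<Sum>i. B * r ^ (i + n))"
      by (rule norm_suminf_le) (use inc s in \<open>auto simp: g_def sums_iff\<close>)
    finally show "\<bar>x 0 + (\<Sum>i. g (i + 0)) - x n\<bar> \<le> B * r ^ n / (1 - r)"
      using s by (simp add: sums_iff)
  qed
qed

lemma square_add_le: "(a + b)\<^sup>2 \<le> 2 * a\<^sup>2 + 2 * (b::real)\<^sup>2"
proof -
  have "0 \<le> (a - b)\<^sup>2" by simp
  then show ?thesis by (simp add: power2_eq_square algebra_simps)
qed

text \<open>A discrete Hardy inequality. Comparing with the last term \<open>x M\<close> of a finite section in place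
  of the limit lets the shifted sum be absorbed without a boundary term.\<close>

lemma weighted_hardy:
  fixes x p :: "nat \<Rightarrow> real"
  assumes inc: "\<And>n. 3 ^ n * (x (Suc n) - x n)\<^sup>2 \<le> p n"
    and P: "\<And>N. (\<Sum>n<N. p n) \<le> P" and l: "x \<longlonglongrightarrow> l"
  shows "(\<Sum>n<N. 3 ^ n * (l - x n)\<^sup>2) \<le> 6 * P"
proof -
  have fin: "(\<Sum>n<M. 3 ^ n * (x M - x n)\<^sup>2) \<le> 6 * P" for M
  proof -
    define a where "a n = 3 ^ n * (x M - x n)\<^sup>2" for n
    have "a n \<le> 2 * p n + 2/3 * a (Suc n)" for n
    proof -
      have "(x M - x n)\<^sup>2 \<le> 2 * (x (Suc n) - x n)\<^sup>2 + 2 * (x M - x (Suc n))\<^sup>2"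
        using square_add_le[of "x (Suc n) - x n" "x M - x (Suc n)"] by simp
      then have "a n \<le> 3 ^ n * (2 * (x (Suc n) - x n)\<^sup>2 + 2 * (x M - x (Suc n))\<^sup>2)"
        unfolding a_def by (rule mult_left_mono) simp
      also have "\<dots> = 2 * (3 ^ n * (x (Suc n) - x n)\<^sup>2) + 2/3 * a (Suc n)"
        unfolding a_def by (simp add: algebra_simps)
      finally show ?thesis using inc[of n] by linarith
    qed
    then have "(\<Sum>n<M. a n) \<le> (\<Sum>n<M. 2 * p n + 2/3 * a (Suc n))" by (rule sum_mono)
    also have "\<dots> = 2 * (\<Sum>n<M. p n) + 2/3 * (\<Sum>n<M. a (Suc n))"
      by (simp add: sum.distrib sum_distrib_left)
    finally have 1: "(\<Sum>n<M. a n) \<le> 2 * (\<Sum>n<M. p n) + 2/3 * (\<Sum>n<M. a (Suc n))" .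
    have "a 0 + (\<Sum>n<M. a (Suc n)) = (\<Sum>n<M. a n) + a M"
      using sum.lessThan_Suc_shift[of a M] sum.lessThan_Suc[of a M] by simp
    moreover have "a M = 0" "a 0 \<ge> 0" unfolding a_def by simp_all
    ultimately show ?thesis using 1 P[of M] unfolding a_def by linarith
  qed
  have lim: "(\<lambda>M. \<Sum>n<N. 3 ^ n * (x M - x n)\<^sup>2) \<longlonglongrightarrow> (\<Sum>n<N. 3 ^ n * (l - x n)\<^sup>2)"
    by (intro tendsto_intros l)
  have "(\<Sum>n<N. 3 ^ n * (x M - x n)\<^sup>2) \<le> 6 * P" if "M \<ge> N" for M
  proof -
    have "(\<Sum>n<N. 3 ^ n * (x M - x n)\<^sup>2) \<le> (\<Sum>n<M. 3 ^ n * (x M - x n)\<^sup>2)"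
      by (rule sum_mono2) (use that in auto)
    then show ?thesis using fin[of M] by linarith
  qed
  then show ?thesis using LIMSEQ_le_const2[OF lim] by blast
qed

text \<open>Squaring the recursion \<open>e (Suc n) \<approx> e n / 3\<close> costs a factor 2 and the weight a factor 3;
  as 2 times 3 times 1/9 is less than 1, the weighted sum absorbs itself.\<close>

lemma weighted_damping:
  fixes e p :: "nat \<Rightarrow> real"
  assumes rec: "\<And>n. 3 ^ n * (e (Suc n) - e n / 3)\<^sup>2 \<le> p n"
    and P: "\<And>N. (\<Sum>n<N. p n) \<le> P"
  shows "(\<Sum>n<N. 3 ^ n * (e n)\<^sup>2) \<le> 3 * (e 0)\<^sup>2 + 18 * P"
proof -
  define a where "a n = 3 ^ n * (e n)\<^sup>2" for n
  have a0: "a n \<ge> 0" for n unfolding a_def by simp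
  have "a (Suc n) \<le> 2/3 * a n + 6 * p n" for n
  proof -
    have "(e (Suc n))\<^sup>2 \<le> 2 * (e n / 3)\<^sup>2 + 2 * (e (Suc n) - e n / 3)\<^sup>2"
      using square_add_le[of "e n / 3" "e (Suc n) - e n / 3"] by simp
    then have "a (Suc n) \<le> 3 ^ Suc n * (2 * (e n / 3)\<^sup>2 + 2 * (e (Suc n) - e n / 3)\<^sup>2)"
      unfolding a_def by (rule mult_left_mono) simp
    also have "\<dots> = 2/3 * a n + 6 * (3 ^ n * (e (Suc n) - e n / 3)\<^sup>2)"
      unfolding a_def by (simp add: power_divide algebra_simps)
    finally show ?thesis using rec[of n] by linarith
  qed
  then have "(\<Sum>n<N. a (Suc n)) \<le> (\<Sum>n<N. 2/3 * a n + 6 * p n)" by (rule sum_mono)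
  also have "\<dots> = 2/3 * (\<Sum>n<N. a n) + 6 * (\<Sum>n<N. p n)"
    by (simp add: sum.distrib sum_distrib_left)
  finally have "(\<Sum>n<N. a (Suc n)) \<le> 2/3 * (\<Sum>n<N. a n) + 6 * (\<Sum>n<N. p n)" .
  moreover have "a 0 + (\<Sum>n<N. a (Suc n)) = (\<Sum>n<N. a n) + a N"
    using sum.lessThan_Suc_shift[of a N] sum.lessThan_Suc[of a N] by simp
  ultimately have "(\<Sum>n<N. a n) \<le> 3 * a 0 + 18 * P" using P[of N] a0[of N] by linarith
  then show ?thesis unfolding a_def by simp
qed

text \<open>Cauchy-Schwarz for the coefficient vectors that occur below; in the first four the sum of the squares
  of the coefficients is rounded up to 1.\<close>

lemma three_square_bounds:
  fixes a b c :: real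
  shows "((a + 2 * b + 2 * c) / 5)\<^sup>2 \<le> a\<^sup>2 + b\<^sup>2 + c\<^sup>2"
    and "((3 * a + b + c) / 10)\<^sup>2 \<le> a\<^sup>2 + b\<^sup>2 + c\<^sup>2"
    and "((5 * a + b - c) / 10)\<^sup>2 \<le> a\<^sup>2 + b\<^sup>2 + c\<^sup>2"
    and "((b - c) / 5)\<^sup>2 \<le> a\<^sup>2 + b\<^sup>2 + c\<^sup>2"
    and "(a + b + c)\<^sup>2 \<le> 3 * (a\<^sup>2 + b\<^sup>2 + c\<^sup>2)"
proof -
  let ?S = "a\<^sup>2 + b\<^sup>2 + c\<^sup>2"
  have S: "0 \<le> ?S" by simp
  have "9 * ?S - (a + 2 * b + 2 * c)\<^sup>2 = (2 * a - b)\<^sup>2 + (2 * a - c)\<^sup>2 + (2 * b - 2 * c)\<^sup>2"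
    by (simp add: power2_eq_square algebra_simps)
  also have "\<dots> \<ge> 0" by simp
  finally show "((a + 2 * b + 2 * c) / 5)\<^sup>2 \<le> ?S" using S unfolding power_divide by (simp, linarith)
  have "11 * ?S - (3 * a + b + c)\<^sup>2 = (a - 3 * b)\<^sup>2 + (a - 3 * c)\<^sup>2 + (b - c)\<^sup>2"
    by (simp add: power2_eq_square algebra_simps)
  also have "\<dots> \<ge> 0" by simp
  finally show "((3 * a + b + c) / 10)\<^sup>2 \<le> ?S" using S unfolding power_divide by (simp, linarith)
  have "27 * ?S - (5 * a + b - c)\<^sup>2 = (a - 5 * b)\<^sup>2 + (a + 5 * c)\<^sup>2 + (b + c)\<^sup>2"
    by (simp add: power2_eq_square algebra_simps)
  also have "\<dots> \<ge> 0" by simp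
  finally show "((5 * a + b - c) / 10)\<^sup>2 \<le> ?S" using S unfolding power_divide by (simp, linarith)
  have "2 * ?S - (b - c)\<^sup>2 = 2 * a\<^sup>2 + (b + c)\<^sup>2"
    by (simp add: power2_eq_square algebra_simps)
  also have "\<dots> \<ge> 0" by simp
  finally show "((b - c) / 5)\<^sup>2 \<le> ?S" using S unfolding power_divide by (simp, linarith)
  have "3 * ?S - (a + b + c)\<^sup>2 = (a - b)\<^sup>2 + (a - c)\<^sup>2 + (b - c)\<^sup>2"
    by (simp add: power2_eq_square algebra_simps)
  also have "\<dots> \<ge> 0" by simp
  finally show "(a + b + c)\<^sup>2 \<le> 3 * ?S" by linarith
qed

section \<open>Bounds for the trace\<close>

context weak_solution
begin

abbreviation apex_load :: "nat \<Rightarrow> 3 \<Rightarrow> real" where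
  "apex_load n \<equiv> load (apex_word n)"

abbreviation apex_quotient :: "nat \<Rightarrow> real" where
  "apex_quotient \<equiv> normal_quotient q u [] 0"

lemma apex_quotient_Suc: "apex_quotient (Suc n) - apex_quotient n = (apex_load n 0 + 2 * apex_load n 1 + 2 * apex_load n 2) / 5"
  using quotient_Suc[of "[]" 0 n] by simp

text \<open>The weights 1/5, 2/5, 2/5 in \<open>load_tail\<close> add up to 1, so a bound for the loads passes to
  their combination.\<close>

lemma load_tail_geometric:
  assumes "\<And>k i. \<bar>load (w @ replicate k j) i\<bar> \<le> D * r ^ k" "0 \<le> r" "r < 1"
  shows "\<bar>load_tail w j\<bar> \<le> D / (1 - r)"
proof -
  have s: "(\<lambda>k. D * r ^ k) sums (D / (1 - r))"
    using sums_mult[OF geometric_sums[of r], of D] assms(2,3) by simp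
  have "norm (load_tail w j) \<le> (\<Sum>k. D * r ^ k)"
    unfolding load_tail_def
  proof (rule norm_suminf_le)
    fix k
    show "norm ((load (w @ replicate k j) j + 2 * load (w @ replicate k j) (j + 1)
      + 2 * load (w @ replicate k j) (j + 2)) / 5) \<le> D * r ^ k"
      using assms(1)[of k j] assms(1)[of k "j + 1"] assms(1)[of k "j + 2"]
      unfolding real_norm_def abs_le_iff by argo
  qed (use s in \<open>simp add: sums_iff\<close>)
  then show ?thesis using s by (simp add: sums_iff)
qed

lemma trace_remainder:
  "remainder (\<lambda>m. u (X_point q m)) (u (q 0)) (- 2/3 * \<nu>) (Suc n)
    = (3/5) ^ Suc n * (2/3 * (\<nu> - apex_quotient n) - (3 * apex_load n 0 + apex_load n 1 + apex_load n 2) / 10)"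
  unfolding remainder_def trace_value by (simp add: algebra_simps)

lemma apex_quotient_0: "apex_quotient 0 = 2 * u (q 0) - u (q 1) - u (q 2)"
  using quotient_eq[of "[]" 0 0] by simp

context
  fixes M :: real
  assumes corner_bound: "\<And>i. \<bar>u (q i)\<bar> \<le> M"
begin

lemma apex_quotient_0_bound: "\<bar>apex_quotient 0\<bar> \<le> 4 * M"
  using corner_bound[of 0] corner_bound[of 1] corner_bound[of 2] unfolding apex_quotient_0 by linarith

text \<open>With bounded \<open>f\<close> all loads at scale \<open>n\<close> are at most \<open>A / 3^n\<close>. Then \<open>3^n * skew n\<close> changes by a
  bounded amount in each step and may grow linearly, which is why \<open>3^m * \<eta> m\<close> is only Lipschitz.\<close>

lemma trace_Linf:
  assumes A: "AE x in \<mu>. \<bar>f x\<bar> \<le> A" "0 \<le> A"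
  obtains \<nu> where
    "\<bar>\<nu>\<bar> \<le> 4 * M + 3/2 * A"
    "\<And>m. m \<ge> 1 \<Longrightarrow> \<bar>5 ^ m * remainder (\<lambda>m. u (X_point q m)) (u (q 0)) (- 2/3 * \<nu>) m\<bar> \<le> 9/2 * A"
    "\<And>m. m \<ge> 1 \<Longrightarrow> \<bar>3 ^ (m + 1) * normal_deriv q u (Y_word (m + 1)) 2
       - 3 ^ m * normal_deriv q u (Y_word m) 2\<bar> \<le> 11 * A"
proof -
  have load: "\<bar>apex_load n i\<bar> \<le> A * (1/3) ^ n" for n i
    using load_bound[OF A, of "apex_word n" i] by simp
  have "\<bar>apex_quotient (Suc n) - apex_quotient n\<bar> \<le> A * (1/3) ^ n" for n
    using load[of n 0] load[of n 1] load[of n 2] unfolding apex_quotient_Suc abs_le_iff by argo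
  then obtain \<nu> where \<nu>: "\<And>n. \<bar>\<nu> - apex_quotient n\<bar> \<le> A * (1/3) ^ n / (1 - 1/3)"
    by (rule geometric_increments) auto
  show ?thesis
  proof
    show "\<bar>\<nu>\<bar> \<le> 4 * M + 3/2 * A"
    proof -
      have "\<bar>\<nu> - apex_quotient 0\<bar> \<le> 3/2 * A" using \<nu>[of 0] by simp
      then show ?thesis using apex_quotient_0_bound by linarith
    qed
    fix m :: nat assume "m \<ge> 1"
    then obtain n where m: "m = Suc n" by (cases m) auto
    define t where "t = 2/3 * (\<nu> - apex_quotient n) - (3 * apex_load n 0 + apex_load n 1 + apex_load n 2) / 10"
    have "\<bar>\<nu> - apex_quotient n\<bar> \<le> 3/2 * (A * (1/3) ^ n)" using \<nu>[of n] by simp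
    then have t: "\<bar>t\<bar> \<le> 3/2 * (A * (1/3) ^ n)"
      using load[of n 0] load[of n 1] load[of n 2] unfolding t_def abs_le_iff by argo
    have "5 ^ m * remainder (\<lambda>m. u (X_point q m)) (u (q 0)) (- 2/3 * \<nu>) m = 3 ^ Suc n * t"
      unfolding m trace_remainder t_def mult.assoc[symmetric] power_mult_distrib[symmetric] by simp
    then have "\<bar>5 ^ m * remainder (\<lambda>m. u (X_point q m)) (u (q 0)) (- 2/3 * \<nu>) m\<bar> = 3 ^ Suc n * \<bar>t\<bar>"
      by (simp add: abs_mult)
    also have "\<dots> \<le> 3 ^ Suc n * (3/2 * (A * (1/3) ^ n))" by (rule mult_left_mono[OF t]) simp
    also have "\<dots> = 9/2 * A" by (simp add: power_divide)
    finally show "\<bar>5 ^ m * remainder (\<lambda>m. u (X_point q m)) (u (q 0)) (- 2/3 * \<nu>) m\<bar> \<le> 9/2 * A" .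
    define c where "c n = - ((5 * apex_load n 0 + apex_load n 1 - apex_load n 2) / 10) + load_tail (apex_word n @ [1]) 2" for n
    have \<eta>: "normal_deriv q u (Y_word (Suc n)) 2 = c n - skew n" for n
      unfolding trace_normal_derivative c_def by simp
    have c: "\<bar>3 ^ Suc n * c n\<bar> \<le> 18/5 * A" for n
    proof -
      have "\<bar>load_tail (apex_word n @ [1]) 2\<bar> \<le> A * (1/3) ^ Suc n / (1 - 1/3)"
      proof (rule load_tail_geometric)
        show "\<bar>load ((apex_word n @ [1]) @ replicate k 2) i\<bar> \<le> A * (1/3) ^ Suc n * (1/3) ^ k" for k i
          using load_bound[OF A, of "(apex_word n @ [1]) @ replicate k 2" i]
          by (simp add: power_add mult_ac)
      qed auto
      then have "\<bar>load_tail (apex_word n @ [1]) 2\<bar> \<le> 1/2 * (A * (1/3) ^ n)" by simp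
      moreover have "\<bar>- ((5 * x + y - z) / 10) + w\<bar> \<le> 6/5 * d"
        if "\<bar>w\<bar> \<le> 1/2 * d" "\<bar>x\<bar> \<le> d" "\<bar>y\<bar> \<le> d" "\<bar>z\<bar> \<le> d" for x y z w d :: real
        by (rule abs_leI) (use that[THEN abs_le_D1] that[THEN abs_le_D2] in argo)+
      ultimately have "\<bar>c n\<bar> \<le> 6/5 * (A * (1/3) ^ n)"
        using load unfolding c_def by blast
      then have "3 ^ Suc n * \<bar>c n\<bar> \<le> 3 ^ Suc n * (6/5 * (A * (1/3) ^ n))"
        by (rule mult_left_mono) simp
      also have "\<dots> = 18/5 * A" by (simp add: power_divide)
      finally show ?thesis by (simp add: abs_mult)
    qed
    have s: "\<bar>3 ^ Suc (Suc n) * skew (Suc n) - 3 ^ Suc n * skew n\<bar> \<le> 18/5 * A"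
    proof -
      have eq: "3 ^ Suc (Suc n) * skew (Suc n) - 3 ^ Suc n * skew n = 3 ^ Suc n * (3/5 * (apex_load n 1 - apex_load n 2))"
        unfolding skew_Suc power_Suc by (simp add: field_simps)
      have pw: "\<bar>3 ^ Suc n :: real\<bar> = 3 ^ Suc n" by simp
      have "\<bar>3/5 * (x - y)\<bar> \<le> 6/5 * d" if "\<bar>x\<bar> \<le> d" "\<bar>y\<bar> \<le> d" for x y d :: real
        by (rule abs_leI) (use that[THEN abs_le_D1] that[THEN abs_le_D2] in argo)+
      then have "3 ^ Suc n * \<bar>3/5 * (apex_load n 1 - apex_load n 2)\<bar> \<le> 3 ^ Suc n * (6/5 * (A * (1/3) ^ n))"
        using load by (intro mult_left_mono) (blast, simp)
      then have "\<bar>3 ^ Suc (Suc n) * skew (Suc n) - 3 ^ Suc n * skew n\<bar> \<le> 3 ^ Suc n * (6/5 * (A * (1/3) ^ n))"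
        unfolding eq abs_mult[of "3 ^ Suc n"] pw .
      also have "\<dots> = 18/5 * A" by (simp add: power_divide)
      finally show ?thesis .
    qed
    have "3 ^ (m + 1) * normal_deriv q u (Y_word (m + 1)) 2 - 3 ^ m * normal_deriv q u (Y_word m) 2
        = 3 ^ Suc (Suc n) * c (Suc n) - 3 ^ Suc n * c n - (3 ^ Suc (Suc n) * skew (Suc n) - 3 ^ Suc n * skew n)"
      unfolding m Suc_eq_plus1[symmetric] \<eta> by (simp add: algebra_simps)
    then show "\<bar>3 ^ (m + 1) * normal_deriv q u (Y_word (m + 1)) 2
       - 3 ^ m * normal_deriv q u (Y_word m) 2\<bar> \<le> 11 * A"
      using c[of n] c[of "Suc n"] s A(2) by linarith
  qed
qed

text \<open>Here \<open>p n\<close> is the mass of the loads at scale \<open>n\<close> in the natural weight \<open>3^n\<close>, summable by the bounded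
  overlap of the tents. The values on the line inherit this through the Hardy inequality, as they
  involve the distance of the quotients at \<open>q 0\<close> to their limit, and the normal derivatives through the
  damped recursion for \<open>skew\<close>.\<close>

lemma trace_L2:
  obtains \<nu> where
    "\<nu>\<^sup>2 \<le> 32 * M\<^sup>2 + 42 * f_sq"
    "\<And>N. (\<Sum>n<N. (25/3) ^ Suc n * (remainder (\<lambda>m. u (X_point q m)) (u (q 0)) (- 2/3 * \<nu>) (Suc n))\<^sup>2)
      \<le> 84 * f_sq"
    "\<And>N. (\<Sum>n<N. 3 ^ Suc n * (normal_deriv q u (Y_word (Suc n)) 2)\<^sup>2) \<le> 108 * M\<^sup>2 + 640 * f_sq"
proof -
  define p where "p n = 3 ^ n * ((apex_load n 0)\<^sup>2 + (apex_load n 1)\<^sup>2 + (apex_load n 2)\<^sup>2)" for n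
  have weight: "(3::real) ^ n * (1/3) ^ n = 1" for n by (simp add: power_divide)
  have p: "(\<Sum>n<N. p n) \<le> 7/2 * f_sq" for N
  proof -
    have "3 ^ n * (apex_load n i)\<^sup>2 \<le> (LINT x|\<mu>. (f x)\<^sup>2 * cell_tent (apex_word n) i x)" for n i
    proof -
      have "3 ^ n * (apex_load n i)\<^sup>2 \<le> 3 ^ n * ((1/3) ^ n * (LINT x|\<mu>. (f x)\<^sup>2 * cell_tent (apex_word n) i x))"
        using load_sq[of "apex_word n" i] by (intro mult_left_mono) simp_all
      then show ?thesis unfolding mult.assoc[symmetric] weight by simp
    qed
    then have "p n \<le> (\<Sum>i\<in>UNIV. LINT x|\<mu>. (f x)\<^sup>2 * cell_tent (apex_word n) i x)" for n
      unfolding sum_three[of _ 0] p_def three_values distrib_left by (intro add_mono)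
    then have "(\<Sum>n<N. p n) \<le> (\<Sum>n<N. \<Sum>i\<in>UNIV. LINT x|\<mu>. (f x)\<^sup>2 * cell_tent (apex_word n) i x)"
      by (intro sum_mono)
    then show ?thesis using integral_tent_sum[OF f_L2, of N] unfolding f_sq_def by linarith
  qed
  have scale: "3 ^ n * a \<le> p n" if "a \<le> (apex_load n 0)\<^sup>2 + (apex_load n 1)\<^sup>2 + (apex_load n 2)\<^sup>2" for a n
    unfolding p_def by (rule mult_left_mono[OF that]) simp
  have inc: "3 ^ n * (apex_quotient (Suc n) - apex_quotient n)\<^sup>2 \<le> p n" for n
    unfolding apex_quotient_Suc by (intro scale three_square_bounds)
  have "\<bar>apex_quotient (Suc n) - apex_quotient n\<bar> \<le> sqrt f_sq * sqrt (1/3) ^ n" for n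
    using load_sqrt_bound[of "apex_word n" 0] load_sqrt_bound[of "apex_word n" 1]
      load_sqrt_bound[of "apex_word n" 2] unfolding apex_quotient_Suc abs_le_iff length_replicate by argo
  then obtain \<nu> where \<nu>: "apex_quotient \<longlonglongrightarrow> \<nu>"
    by (rule geometric_increments) auto
  have hardy: "(\<Sum>n<N. 3 ^ n * (\<nu> - apex_quotient n)\<^sup>2) \<le> 6 * (7/2 * f_sq)" for N
    by (rule weighted_hardy[OF inc p \<nu>])
  show ?thesis
  proof
    have "(\<nu> - apex_quotient 0)\<^sup>2 \<le> 21 * f_sq" using hardy[of 1] by simp
    moreover have "(apex_quotient 0)\<^sup>2 \<le> (4 * M)\<^sup>2" using apex_quotient_0_bound by (rule abs_le_square_iff[THEN iffD1, OF order_trans]) simp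
    ultimately show "\<nu>\<^sup>2 \<le> 32 * M\<^sup>2 + 42 * f_sq"
      using square_add_le[of "\<nu> - apex_quotient 0" "apex_quotient 0"] by (simp add: power_mult_distrib)
    fix N
    define r where "r n = remainder (\<lambda>m. u (X_point q m)) (u (q 0)) (- 2/3 * \<nu>) (Suc n)" for n
    have "(25/3) ^ Suc n * (r n)\<^sup>2 \<le> 3 * (3 ^ n * (\<nu> - apex_quotient n)\<^sup>2) + 6 * p n" for n
    proof -
      define h where "h = (3 * apex_load n 0 + apex_load n 1 + apex_load n 2) / 10"
      have "(25/3) ^ k * ((3/5) ^ k * t)\<^sup>2 = 3 ^ k * t\<^sup>2" for k and t :: real
      proof -
        have "((3/5::real) ^ k)\<^sup>2 = ((3/5)\<^sup>2) ^ k" by (simp only: power_mult[symmetric] mult.commute)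
        then have "(25/3) ^ k * ((3/5) ^ k * t)\<^sup>2 = ((25/3) ^ k * ((3/5)\<^sup>2) ^ k) * t\<^sup>2"
          by (simp only: power_mult_distrib mult.assoc)
        also have "(25/3) ^ k * ((3/5)\<^sup>2) ^ k = (3::real) ^ k"
          unfolding power_mult_distrib[symmetric] by (simp add: power2_eq_square)
        finally show ?thesis .
      qed
      then have "(25/3) ^ Suc n * (r n)\<^sup>2 = 3 ^ Suc n * (2/3 * (\<nu> - apex_quotient n) - h)\<^sup>2"
        unfolding r_def trace_remainder h_def by blast
      also have "\<dots> \<le> 3 ^ Suc n * (2 * (2/3 * (\<nu> - apex_quotient n))\<^sup>2 + 2 * h\<^sup>2)"
        using square_add_le[of "2/3 * (\<nu> - apex_quotient n)" "- h"] by (intro mult_left_mono) simp_all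
      also have "\<dots> = 8/3 * (3 ^ n * (\<nu> - apex_quotient n)\<^sup>2) + 6 * (3 ^ n * h\<^sup>2)"
        by (simp add: power_mult_distrib power2_eq_square algebra_simps)
      also have "\<dots> \<le> 3 * (3 ^ n * (\<nu> - apex_quotient n)\<^sup>2) + 6 * p n"
        using scale[of "h\<^sup>2" n] three_square_bounds(2)[of "apex_load n 0" "apex_load n 1" "apex_load n 2"]
        unfolding h_def by (intro add_mono mult_right_mono mult_left_mono) auto
      finally show ?thesis .
    qed
    then have "(\<Sum>n<N. (25/3) ^ Suc n * (r n)\<^sup>2) \<le> (\<Sum>n<N. 3 * (3 ^ n * (\<nu> - apex_quotient n)\<^sup>2) + 6 * p n)"
      by (rule sum_mono)
    also have "\<dots> = 3 * (\<Sum>n<N. 3 ^ n * (\<nu> - apex_quotient n)\<^sup>2) + 6 * (\<Sum>n<N. p n)"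
      by (simp add: sum.distrib sum_distrib_left)
    also have "\<dots> \<le> 84 * f_sq" using hardy[of N] p[of N] by linarith
    finally show "(\<Sum>n<N. (25/3) ^ Suc n * (remainder (\<lambda>m. u (X_point q m)) (u (q 0)) (- 2/3 * \<nu>) (Suc n))\<^sup>2)
      \<le> 84 * f_sq" unfolding r_def .
    define Q where "Q n = (LINT x|\<mu>. (f x)\<^sup>2 * indicator (side_cell n) x)" for n
    have Q0: "0 \<le> Q n" for n unfolding Q_def by (intro integral_nonneg_AE AE_I2) simp
    have tail: "3 ^ n * (load_tail (apex_word n @ [1]) 2)\<^sup>2 \<le> 25/12 * Q n" for n
    proof -
      \<comment> \<open>The loads decay by \<open>sqrt (1/3)\<close> in each step, which is rounded up to 3/5.\<close>
      define D where "D = sqrt ((1/3) ^ Suc n * Q n)"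
      have D: "0 \<le> D" "D\<^sup>2 = (1/3) ^ Suc n * Q n"
        unfolding D_def using Q0[of n] by (simp_all del: power_Suc)
      have "\<bar>load_tail (apex_word n @ [1]) 2\<bar> \<le> D / (1 - 3/5)"
      proof (rule load_tail_geometric)
        fix k i
        have "(load ((apex_word n @ [1]) @ replicate k 2) i)\<^sup>2 \<le> (1/3) ^ (Suc n + k) * Q n"
          using load_sq_subcell[of "apex_word n @ [1]" "replicate k 2" i] unfolding Q_def by simp
        also have "\<dots> = D\<^sup>2 * (1/3) ^ k" unfolding D by (simp add: power_add)
        also have "\<dots> \<le> D\<^sup>2 * ((3/5)\<^sup>2) ^ k"
          by (intro mult_left_mono power_mono) (simp_all add: power2_eq_square)
        also have "\<dots> = (D * (3/5) ^ k)\<^sup>2"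
          by (simp only: power_mult_distrib power_mult[symmetric] mult.commute)
        finally have "\<bar>load ((apex_word n @ [1]) @ replicate k 2) i\<bar> \<le> \<bar>D * (3/5) ^ k\<bar>"
          unfolding abs_le_square_iff .
        then show "\<bar>load ((apex_word n @ [1]) @ replicate k 2) i\<bar> \<le> D * (3/5) ^ k"
          using D(1) by (simp add: abs_mult)
      qed simp_all
      then have "(load_tail (apex_word n @ [1]) 2)\<^sup>2 \<le> (5/2 * D)\<^sup>2"
        using D(1) by (simp add: abs_le_square_iff[symmetric])
      then have "3 ^ n * (load_tail (apex_word n @ [1]) 2)\<^sup>2 \<le> 3 ^ n * (5/2 * D)\<^sup>2"
        by (rule mult_left_mono) simp
      also have "\<dots> = 25/12 * Q n"
        unfolding power_mult_distrib D by (simp add: power2_eq_square power_divide)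
      finally show ?thesis .
    qed
    have "3 ^ Suc n * (normal_deriv q u (Y_word (Suc n)) 2)\<^sup>2
        \<le> 9 * (3 ^ n * (skew n)\<^sup>2) + 9 * p n + 20 * Q n" for n
    proof -
      define a b c where "a = - skew n" and "b = - ((5 * apex_load n 0 + apex_load n 1 - apex_load n 2) / 10)"
        and "c = load_tail (apex_word n @ [1]) 2"
      have "3 ^ Suc n * (normal_deriv q u (Y_word (Suc n)) 2)\<^sup>2 = 3 ^ Suc n * (a + b + c)\<^sup>2"
        unfolding trace_normal_derivative a_def b_def c_def by simp
      also have "\<dots> \<le> 3 ^ Suc n * (3 * (a\<^sup>2 + b\<^sup>2 + c\<^sup>2))"
        by (intro mult_left_mono three_square_bounds) simp
      also have "\<dots> = 9 * (3 ^ n * a\<^sup>2) + 9 * (3 ^ n * b\<^sup>2) + 9 * (3 ^ n * c\<^sup>2)"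
        by (simp add: algebra_simps)
      also have "\<dots> \<le> 9 * (3 ^ n * (skew n)\<^sup>2) + 9 * p n + 20 * Q n"
      proof -
        have "3 ^ n * b\<^sup>2 \<le> p n"
          unfolding b_def power2_minus by (intro scale three_square_bounds)
        moreover have "3 ^ n * c\<^sup>2 \<le> 25/12 * Q n" unfolding c_def by (rule tail)
        moreover have "a\<^sup>2 = (skew n)\<^sup>2" unfolding a_def by simp
        ultimately show ?thesis using Q0[of n] by simp
      qed
      finally show ?thesis .
    qed
    then have "(\<Sum>n<N. 3 ^ Suc n * (normal_deriv q u (Y_word (Suc n)) 2)\<^sup>2)
        \<le> (\<Sum>n<N. 9 * (3 ^ n * (skew n)\<^sup>2) + 9 * p n + 20 * Q n)" by (rule sum_mono)
    also have "\<dots> = 9 * (\<Sum>n<N. 3 ^ n * (skew n)\<^sup>2) + 9 * (\<Sum>n<N. p n) + 20 * (\<Sum>n<N. Q n)"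
      by (simp add: sum.distrib sum_distrib_left)
    also have "\<dots> \<le> 9 * (3 * (skew 0)\<^sup>2 + 18 * (7/2 * f_sq)) + 9 * (7/2 * f_sq) + 20 * (2 * f_sq)"
    proof (intro add_mono mult_left_mono p)
      show "(\<Sum>n<N. 3 ^ n * (skew n)\<^sup>2) \<le> 3 * (skew 0)\<^sup>2 + 18 * (7/2 * f_sq)"
      proof (rule weighted_damping[OF _ p])
        show "3 ^ n * (skew (Suc n) - skew n / 3)\<^sup>2 \<le> p n" for n
          using scale[OF three_square_bounds(4)] unfolding skew_Suc by simp
      qed
      show "(\<Sum>n<N. Q n) \<le> 2 * f_sq"
        using integral_side_cells[OF f_L2, of N] unfolding Q_def f_sq_def .
    qed simp_all
    also have "\<dots> \<le> 108 * M\<^sup>2 + 640 * f_sq"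
    proof -
      have "\<bar>skew 0\<bar> \<le> 2 * M"
        using corner_bound[of 1] corner_bound[of 2] unfolding skew_def by simp
      then have "(skew 0)\<^sup>2 \<le> (2 * M)\<^sup>2" by (rule abs_le_square_iff[THEN iffD1, OF order_trans]) simp
      then show ?thesis using f_sq_nonneg by (simp add: power_mult_distrib)
    qed
    finally show "(\<Sum>n<N. 3 ^ Suc n * (normal_deriv q u (Y_word (Suc n)) 2)\<^sup>2) \<le> 108 * M\<^sup>2 + 640 * f_sq" .
  qed
qed

end

end

section \<open>Corner values are controlled by square means\<close>

text \<open>The trace bounds above are in terms of the corner values of \<open>u\<close>, the theorem is in terms of norms of
  \<open>u\<close>. If \<open>M\<close> is the largest absolute corner value, then, up to a multiple of the square norm of
  \<open>f\<close>, the 1/5-2/5 rule keeps \<open>\<bar>u\<bar>\<close> above a fixed fraction of \<open>M\<close> on the cell of level 2 at that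
  corner. So \<open>M\<close> is at most a multiple of the square norms of \<open>u\<close> and \<open>f\<close>.\<close>

context gasket
begin

lemma vertices_words: "x \<in> V m \<Longrightarrow> \<exists>w i. x = W w (q i)"
proof (induction m arbitrary: x)
  case 0
  then obtain i where "x = W [] (q i)" by auto
  then show ?case by blast
next
  case (Suc m)
  then obtain j y where y: "y \<in> V m" "x = F j y" by auto
  then obtain w i where "y = W w (q i)" using Suc.IH by blast
  then have "x = W (j # w) (q i)" using y by simp
  then show ?case by blast
qed

end

context weak_solution
begin

lemma err_bound: "\<bar>err w i\<bar> \<le> (3/5) ^ Suc (length w) * sqrt f_sq"
proof -
  have "\<bar>load w i\<bar> \<le> sqrt f_sq * sqrt (1/3) ^ length w" by (rule load_sqrt_bound)
  also have "\<dots> \<le> sqrt f_sq * 1"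
    by (intro mult_left_mono power_le_one) (simp_all add: f_sq_nonneg)
  finally have "\<bar>load w i\<bar> \<le> sqrt f_sq" by simp
  then have "(3/5) ^ Suc (length w) * \<bar>load w i\<bar> \<le> (3/5) ^ Suc (length w) * sqrt f_sq"
    by (rule mult_left_mono) simp
  then show ?thesis unfolding err_def abs_mult by simp
qed

text \<open>The sign \<open>s\<close> gives lower and upper bounds at once.\<close>

context
  fixes s :: real
  assumes s: "\<bar>s\<bar> = 1"
begin

lemma junction_lower:
  "(s * u (W w (q i)) + 2 * (s * u (W w (q (i + 1)))) + 2 * (s * u (W w (q (i + 2))))) / 5
      - 1/2 * ((3/5) ^ Suc (length w) * sqrt f_sq) \<le> s * u (W w (junction i))"
proof -
  have e: "\<bar>s * err w k\<bar> \<le> (3/5) ^ Suc (length w) * sqrt f_sq" for k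
    unfolding abs_mult s using err_bound[of w k] by simp
  have "5 * (s * u (W w (junction i))) = s * (5 * u (W w (junction i)))" by simp
  also have "\<dots> = s * u (W w (q i)) + 2 * (s * u (W w (q (i + 1)))) + 2 * (s * u (W w (q (i + 2))))
      - (3 * (s * err w i) + s * err w (i + 1) + s * err w (i + 2)) / 2"
    unfolding junction_value by (simp add: algebra_simps add_divide_distrib)
  finally show ?thesis
    using e[of i, THEN abs_le_D1] e[of "i + 1", THEN abs_le_D1] e[of "i + 2", THEN abs_le_D1] by argo
qed

text \<open>A junction value is a mean of corner values up to \<open>1/2 * (3/5)^n * sqrt f_sq\<close>, where the cell has
  level \<open>n - 1\<close>; these errors add up to at most 3/4.\<close>

lemma minimum_principle:
  assumes b: "\<And>i. b \<le> s * u (W v (q i))"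
  shows "b - 3/4 * sqrt f_sq \<le> s * u (W (v @ w) (q i))"
proof -
  have "b - 3/4 * sqrt f_sq * (1 - (3/5) ^ length w) \<le> s * u (W (v @ w) (q i))"
  proof (induction w arbitrary: i rule: rev_induct)
    case (snoc j w)
    have m: "b - 3/4 * sqrt f_sq * (1 - (3/5) ^ Suc (length w)) \<le> s * u (W (v @ w) (junction k))" for k
    proof -
      let ?b = "b - 3/4 * sqrt f_sq * (1 - (3/5) ^ length w)"
      have "(3/5::real) ^ Suc (length (v @ w)) \<le> (3/5) ^ Suc (length w)"
        by (rule power_decreasing) auto
      then have "(3/5) ^ Suc (length (v @ w)) * sqrt f_sq \<le> (3/5) ^ Suc (length w) * sqrt f_sq"
        by (rule mult_right_mono) (simp add: f_sq_nonneg)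
      then have "?b - 1/2 * ((3/5) ^ Suc (length w) * sqrt f_sq) \<le> s * u (W (v @ w) (junction k))"
        using snoc[of k] snoc[of "k + 1"] snoc[of "k + 2"] junction_lower[of "v @ w" k] by argo
      moreover have "?b - 1/2 * ((3/5) ^ Suc (length w) * sqrt f_sq)
          = b - 3/4 * sqrt f_sq * (1 - (3/5) ^ Suc (length w))"
        by (simp add: field_simps)
      ultimately show ?thesis by (simp only:)
    qed
    show ?case
    proof (cases rule: three_cases[of i j])
      case 1
      have "(3/5::real) ^ Suc (length w) \<le> (3/5) ^ length w"
        by (rule power_decreasing) auto
      then have "3/4 * sqrt f_sq * (1 - (3/5) ^ length w) \<le> 3/4 * sqrt f_sq * (1 - (3/5) ^ Suc (length w))"
        by (intro mult_left_mono) (simp_all add: f_sq_nonneg)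
      then have "b - 3/4 * sqrt f_sq * (1 - (3/5) ^ Suc (length w)) \<le> b - 3/4 * sqrt f_sq * (1 - (3/5) ^ length w)"
        by (rule diff_left_mono)
      also have "\<dots> \<le> s * u (W (v @ w) (q j))" by (rule snoc)
      also have "W (v @ w) (q j) = W (v @ w @ [j]) (q i)" using 1 by (simp add: word_append)
      finally show ?thesis by (simp only: length_append_singleton)
    next
      case 2
      then have "W (v @ w @ [j]) (q i) = W (v @ w) (junction (j + 2))"
        using map_vertex_junction(1)[of j] by (simp add: word_append)
      then show ?thesis using m[of "j + 2"] by simp
    next
      case 3
      then have "W (v @ w @ [j]) (q i) = W (v @ w) (junction (j + 1))"
        using map_vertex_junction(2)[of j] by (simp add: word_append)
      then show ?thesis using m[of "j + 1"] by simp
    qed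
  qed (simp add: b)
  moreover have "3/4 * sqrt f_sq * (1 - (3/5) ^ length w) \<le> 3/4 * sqrt f_sq * 1"
    by (intro mult_left_mono) (simp_all add: f_sq_nonneg)
  ultimately show ?thesis by simp
qed

text \<open>From the corner values \<open>M\<close> and at least \<open>- M\<close> the 1/5-2/5 rule gives at least \<open>- M / 5\<close> at the two
  junctions next to the corner \<open>j\<close>, and at least \<open>7/25 * M\<close> one step further, up to
  multiples of \<open>sqrt f_sq\<close>.\<close>

lemma corner_cell_lower:
  assumes j: "s * u (q j) = M" and M: "\<And>i. \<bar>u (q i)\<bar> \<le> M" and u: "continuous_on K u" and x: "x \<in> K"
  shows "7/25 * M - 6/5 * sqrt f_sq \<le> s * u (W [j, j] x)"
proof -
  have lo: "- M \<le> s * u (q i)" for i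
    using M[of i] s abs_mult[of s "u (q i)"] by simp
  have k: "0 \<le> sqrt f_sq" by (simp add: f_sq_nonneg)
  have M0: "0 \<le> M" using M[of 0] by linarith
  have corner1: "W [j] (q (j + 1)) = junction (j + 2)" "W [j] (q (j + 2)) = junction (j + 1)" "W [j] (q j) = q j"
    using map_vertex_junction[of j] by simp_all
  have 1: "- M / 5 - 3/10 * sqrt f_sq \<le> s * u (junction (j + 2))"
    "- M / 5 - 3/10 * sqrt f_sq \<le> s * u (junction (j + 1))"
    using junction_lower[of "[]" "j + 2", unfolded three_add] junction_lower[of "[]" "j + 1", unfolded three_add]
      lo[of "j + 1"] lo[of "j + 2"] j by simp_all argo+
  have corner2: "W [j, j] (q (j + 1)) = W [j] (junction (j + 2))" "W [j, j] (q (j + 2)) = W [j] (junction (j + 1))"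
    "W [j, j] (q j) = q j"
    using map_vertex_junction[of j] by simp_all
  have 2: "7/25 * M - 9/25 * sqrt f_sq \<le> s * u (W [j] (junction (j + 2)))"
    "7/25 * M - 9/25 * sqrt f_sq \<le> s * u (W [j] (junction (j + 1)))"
    using junction_lower[of "[j]" "j + 2", unfolded three_add corner1]
      junction_lower[of "[j]" "j + 1", unfolded three_add corner1] 1 j
    by (simp_all add: power2_eq_square) argo+
  have "7/25 * M - 9/25 * sqrt f_sq \<le> s * u (W [j, j] (q i))" for i
    using three_cases[of i j]
  proof cases
    case 1
    have "7/25 * M - 9/25 * sqrt f_sq \<le> M" using k M0 by argo
    then show ?thesis unfolding 1 corner2 j .
  qed (use 2 corner2 in simp_all)
  then have "7/25 * M - 9/25 * sqrt f_sq - 3/4 * sqrt f_sq \<le> s * u (W [j, j] (W w (q i)))" for w i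
    unfolding word_append[symmetric] by (rule minimum_principle)
  moreover have "7/25 * M - 6/5 * sqrt f_sq \<le> 7/25 * M - 9/25 * sqrt f_sq - 3/4 * sqrt f_sq"
    using k by argo
  ultimately have "7/25 * M - 6/5 * sqrt f_sq \<le> s * u (W [j, j] (W w (q i)))" for w i
    using order_trans by blast
  then have v: "7/25 * M - 6/5 * sqrt f_sq \<le> s * u (W [j, j] y)" if "y \<in> (\<Union>m. V m)" for y
    using that vertices_words by blast
  have "continuous_on (closure (\<Union>m. V m)) (\<lambda>x. s * (u \<circ> W [j, j]) x)"
    unfolding SG_closure[symmetric] by (intro continuous_intros continuous_word_comp u)
  then show ?thesis
    using continuous_ge_on_closure[of "\<Union>m. V m" "\<lambda>x. s * (u \<circ> W [j, j]) x" x "7/25 * M - 6/5 * sqrt f_sq"]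
      v x unfolding SG_closure by simp
qed

end

lemma continuous_sq_integrable:
  assumes "continuous_on K u"
  shows "integrable \<mu> (\<lambda>x. (u x)\<^sup>2)"
proof -
  obtain B where B: "\<And>x. x \<in> K \<Longrightarrow> (u x)\<^sup>2 \<le> B"
    using continuous_attains_sup[OF compact_SG _ continuous_on_power[OF assms], of 2] vertex_in_SG[of 0] by blast
  show ?thesis
  proof (rule integrable_const_bound)
    show "AE x in \<mu>. norm ((u x)\<^sup>2) \<le> B" using B by (intro AE_I2) (simp add: space_mu)
    show "(\<lambda>x. (u x)\<^sup>2) \<in> borel_measurable \<mu>"
      by (rule continuous_measurable[OF continuous_on_power[OF assms]])
  qed
qed

lemma corner_values:
  assumes u: "continuous_on K u"
  shows "\<bar>u (q i)\<bar> \<le> 11 * L2_norm \<mu> u + 8 * sqrt f_sq"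
proof -
  define M where "M = Max (range (\<lambda>i. \<bar>u (q i)\<bar>))"
  have "M \<in> range (\<lambda>i. \<bar>u (q i)\<bar>)" unfolding M_def by (rule Max_in) auto
  then obtain j where j: "\<bar>u (q j)\<bar> = M" by auto
  have M: "\<bar>u (q i)\<bar> \<le> M" for i unfolding M_def by (rule Max_ge) auto
  define s :: real where "s = (if u (q j) \<ge> 0 then 1 else - 1)"
  have s: "\<bar>s\<bar> = 1" "s * u (q j) = M" using j unfolding s_def by auto
  define b where "b = 7/25 * M - 6/5 * sqrt f_sq"
  have lower: "b \<le> s * u (W [j, j] x)" if "x \<in> K" for x
    unfolding b_def by (rule corner_cell_lower[OF s M u that])
  have norm: "0 \<le> L2_norm \<mu> u" "(L2_norm \<mu> u)\<^sup>2 = (LINT x|\<mu>. (u x)\<^sup>2)"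
    unfolding L2_norm_def by simp_all
  have "b \<le> 3 * L2_norm \<mu> u"
  proof (cases "b \<le> 0")
    case False
    let ?C = "W [j, j] ` K"
    have sub: "?C \<inter> space \<mu> = ?C" using cell_subset[of "[j, j]"] space_mu by blast
    have "b\<^sup>2 * measure \<mu> ?C = (LINT x|\<mu>. b\<^sup>2 * indicator ?C x)"
      by (simp only: Bochner_Integration.integral_mult_right_zero Bochner_Integration.integral_indicator sub)
    also have "\<dots> \<le> (LINT x|\<mu>. (u x)\<^sup>2)"
    proof (rule integral_mono)
      show "integrable \<mu> (\<lambda>x. b\<^sup>2 * indicator ?C x)"
        using cell_measurable[of "[j, j]"]
        by (intro integrable_mult_right) (simp add: integrable_indicator_iff sub emeasure_finite less_top[symmetric])
      show "integrable \<mu> (\<lambda>x. (u x)\<^sup>2)" by (rule continuous_sq_integrable[OF u])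
      fix x assume "x \<in> space \<mu>"
      have "b\<^sup>2 \<le> (u x)\<^sup>2" if xC: "x \<in> ?C"
      proof -
        obtain y where "y \<in> K" "x = W [j, j] y" using xC by blast
        then have "b \<le> s * u x" using lower[of y] by simp
        then have "\<bar>b\<bar> \<le> \<bar>s * u x\<bar>" using False by linarith
        then show ?thesis unfolding abs_mult s by (simp add: abs_le_square_iff)
      qed
      then show "b\<^sup>2 * indicator ?C x \<le> (u x)\<^sup>2" by (auto simp: indicator_def)
    qed
    finally have "b\<^sup>2 \<le> (3 * L2_norm \<mu> u)\<^sup>2"
      unfolding norm(2)[symmetric] measure_cell by (simp add: power_mult_distrib power2_eq_square)
    then have "\<bar>b\<bar> \<le> \<bar>3 * L2_norm \<mu> u\<bar>" unfolding abs_le_square_iff .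
    then show ?thesis using norm(1) by simp
  qed (use norm(1) in linarith)
  then have "M \<le> 11 * L2_norm \<mu> u + 8 * sqrt f_sq"
    using norm(1) f_sq_nonneg real_sqrt_ge_zero[of f_sq] unfolding b_def by argo
  then show ?thesis using M[of i] by linarith
qed

end

section \<open>The trace norms\<close>

lemma linf_bounded:
  assumes "\<And>m. m \<ge> 1 \<Longrightarrow> \<bar>c m\<bar> \<le> B"
  shows "in_linf c" "linf_norm c \<le> B"
proof -
  show "in_linf c" unfolding in_linf_def bdd_above_def using assms by auto
  show "linf_norm c \<le> B" unfolding linf_norm_def by (rule cSUP_least) (use assms in auto)
qed

lemma Lip_bounded:
  assumes "\<And>m. m \<ge> 1 \<Longrightarrow> \<bar>c (m + 1) - c m\<bar> \<le> B"
  shows "in_Lip c" "Lip_norm c \<le> B"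
proof -
  show "in_Lip c" unfolding in_Lip_def bdd_above_def using assms by auto
  show "Lip_norm c \<le> B" unfolding Lip_norm_def by (rule cSUP_least) (use assms in auto)
qed

lemma l2_bounded:
  assumes "\<And>N. (\<Sum>n<N. (c (Suc n))\<^sup>2) \<le> B"
  shows "in_l2 c" "(l2_norm c)\<^sup>2 \<le> B"
proof -
  have fin: "(\<Sum>m\<in>S. (c m)\<^sup>2) \<le> B" if S: "finite S" "S \<subseteq> {1..}" for S
  proof -
    obtain N where N: "\<And>m. m \<in> S \<Longrightarrow> m < N" using S(1) finite_nat_bounded by blast
    have "S \<subseteq> Suc ` {..<N}"
    proof
      fix m assume "m \<in> S"
      then have "m = Suc (m - 1)" "m - 1 < N" using S(2) N[of m] by auto
      then show "m \<in> Suc ` {..<N}" by blast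
    qed
    then have "(\<Sum>m\<in>S. (c m)\<^sup>2) \<le> (\<Sum>m\<in>Suc ` {..<N}. (c m)\<^sup>2)" by (intro sum_mono2) auto
    also have "\<dots> = (\<Sum>n<N. (c (Suc n))\<^sup>2)" by (simp add: sum.reindex)
    finally show ?thesis using assms[of N] by linarith
  qed
  show s: "in_l2 c" unfolding in_l2_def
    by (rule nonneg_bdd_above_summable_on) (use fin in \<open>auto simp: bdd_above_def\<close>)
  have "(l2_norm c)\<^sup>2 = (\<Sum>\<^sub>\<infinity>m\<in>{1..}. (c m)\<^sup>2)"
    unfolding l2_norm_def by (simp add: infsum_nonneg)
  also have "\<dots> \<le> B"
    by (rule infsum_le_finite_sums) (use s fin in \<open>auto simp: in_l2_def\<close>)
  finally show "(l2_norm c)\<^sup>2 \<le> B" .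
qed

text \<open>The two constants are determined as soon as the remainder is \<open>o((3/5)^m)\<close>, which both
  trace spaces imply.\<close>

lemma remainder_unique:
  assumes a: "(\<lambda>m. (5/3) ^ m * remainder a A1 A2 m) \<longlonglongrightarrow> 0"
    and b: "(\<lambda>m. (5/3) ^ m * remainder a B1 B2 m) \<longlonglongrightarrow> 0"
  shows "A1 = B1 \<and> A2 = B2"
proof -
  have p: "(5/3::real) ^ m * (3/5) ^ m = 1" for m
    unfolding power_mult_distrib[symmetric] by simp
  have "(\<lambda>m. (5/3) ^ m * remainder a A1 A2 m - (5/3) ^ m * remainder a B1 B2 m) \<longlonglongrightarrow> 0"
    using tendsto_diff[OF a b] by simp
  moreover have "(5/3) ^ m * remainder a A1 A2 m - (5/3) ^ m * remainder a B1 B2 m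
      = (5/3) ^ m * (B1 - A1) + (B2 - A2)" for m
  proof -
    have "(5/3) ^ m * remainder a A1 A2 m - (5/3) ^ m * remainder a B1 B2 m
        = (5/3) ^ m * (B1 - A1) + ((5/3) ^ m * (3/5) ^ m) * (B2 - A2)"
      unfolding remainder_def by (simp add: algebra_simps)
    then show ?thesis unfolding p by simp
  qed
  ultimately have d: "(\<lambda>m. (5/3) ^ m * (B1 - A1) + (B2 - A2)) \<longlonglongrightarrow> 0" by simp
  have z: "(\<lambda>m. (3/5::real) ^ m) \<longlonglongrightarrow> 0" by (rule LIMSEQ_power_zero) simp
  have "(\<lambda>m. (3/5) ^ m * ((5/3) ^ m * (B1 - A1) + (B2 - A2))) \<longlonglongrightarrow> 0"
    using tendsto_mult[OF z d] by simp
  moreover have "(3/5) ^ m * ((5/3) ^ m * (B1 - A1) + (B2 - A2)) = (B1 - A1) + (3/5) ^ m * (B2 - A2)" for m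
  proof -
    have "(3/5) ^ m * ((5/3) ^ m * (B1 - A1) + (B2 - A2)) = ((5/3) ^ m * (3/5) ^ m) * (B1 - A1) + (3/5) ^ m * (B2 - A2)"
      by (simp add: algebra_simps)
    then show ?thesis unfolding p by simp
  qed
  ultimately have "(\<lambda>m. (B1 - A1) + (3/5) ^ m * (B2 - A2)) \<longlonglongrightarrow> 0" by simp
  moreover have "(\<lambda>m. (B1 - A1) + (3/5) ^ m * (B2 - A2)) \<longlonglongrightarrow> (B1 - A1) + 0 * (B2 - A2)"
    by (intro tendsto_intros z)
  ultimately have e: "B1 - A1 = 0" using LIMSEQ_unique by fastforce
  then have "(\<lambda>m. B2 - A2) \<longlonglongrightarrow> 0" using d by simp
  then have "B2 - A2 = 0" by (simp add: LIMSEQ_const_iff)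
  then show ?thesis using e by simp
qed

lemma half_powr: "0 < b \<Longrightarrow> (b powr (real m / 2))\<^sup>2 = b ^ m"
  unfolding power2_eq_square powr_add[symmetric] by (simp add: powr_realpow)

lemma in_linf_decay:
  assumes "in_linf (\<lambda>m. 5 ^ m * r m)"
  shows "(\<lambda>m. (5/3) ^ m * r m) \<longlonglongrightarrow> 0"
proof -
  obtain B where B: "\<And>m. m \<ge> 1 \<Longrightarrow> \<bar>5 ^ m * r m\<bar> \<le> B"
    using assms unfolding in_linf_def bdd_above_def by auto
  show ?thesis
  proof (rule Lim_null_comparison)
    show "\<forall>\<^sub>F m in sequentially. norm ((5/3) ^ m * r m) \<le> B * (1/3) ^ m"
    proof (rule eventually_sequentiallyI[of 1])
      fix m :: nat assume "m \<ge> 1"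
      have "norm ((5/3) ^ m * r m) = \<bar>5 ^ m * r m\<bar> * (1/3) ^ m"
        by (simp add: abs_mult power_divide)
      also have "\<dots> \<le> B * (1/3) ^ m" by (rule mult_right_mono[OF B[OF \<open>m \<ge> 1\<close>]]) simp
      finally show "norm ((5/3) ^ m * r m) \<le> B * (1/3) ^ m" .
    qed
    show "(\<lambda>m. B * (1/3) ^ m) \<longlonglongrightarrow> 0"
      by (intro tendsto_mult_right_zero LIMSEQ_power_zero) simp
  qed
qed

lemma in_l2_decay:
  assumes "in_l2 (\<lambda>m. (25/3) powr (real m / 2) * r m)"
  shows "(\<lambda>m. (5/3) ^ m * r m) \<longlonglongrightarrow> 0"
proof -
  define g where "g m = (25/3) ^ m * (r m)\<^sup>2" for m
  have g: "g summable_on {1..}"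
    using assms unfolding in_l2_def g_def power_mult_distrib by (simp add: half_powr)
  have g0: "0 \<le> g m" for m unfolding g_def by simp
  have B: "g m \<le> infsum g {1..}" if "m \<ge> 1" for m
    using finite_sum_le_infsum[OF g, of "{m}"] that g0 by simp
  have "(\<lambda>m. ((5/3) ^ m * r m)\<^sup>2) \<longlonglongrightarrow> 0"
  proof (rule Lim_null_comparison)
    show "\<forall>\<^sub>F m in sequentially. norm (((5/3) ^ m * r m)\<^sup>2) \<le> infsum g {1..} * (1/3) ^ m"
    proof (rule eventually_sequentiallyI[of 1])
      fix m :: nat assume m: "m \<ge> 1"
      have "((5/3::real) ^ m)\<^sup>2 = ((5/3)\<^sup>2) ^ m" by (simp only: power_mult[symmetric] mult.commute)
      also have "\<dots> = (25/3) ^ m * (1/3) ^ m"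
        unfolding power_mult_distrib[symmetric] by (simp add: power2_eq_square)
      finally have "norm (((5/3) ^ m * r m)\<^sup>2) = g m * (1/3) ^ m"
        unfolding g_def power_mult_distrib by simp
      also have "\<dots> \<le> infsum g {1..} * (1/3) ^ m" by (rule mult_right_mono[OF B[OF m]]) simp
      finally show "norm (((5/3) ^ m * r m)\<^sup>2) \<le> infsum g {1..} * (1/3) ^ m" .
    qed
    show "(\<lambda>m. infsum g {1..} * (1/3) ^ m) \<longlonglongrightarrow> 0"
      by (intro tendsto_mult_right_zero LIMSEQ_power_zero) simp
  qed
  then have "(\<lambda>m. sqrt (((5/3) ^ m * r m)\<^sup>2)) \<longlonglongrightarrow> sqrt 0" by (rule tendsto_real_sqrt)
  then show ?thesis by (simp add: tendsto_rabs_zero_iff)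
qed

lemma T_inf_norm_eq:
  assumes "in_linf (\<lambda>m. 5 ^ m * remainder a A1 A2 m)"
  shows "T_inf_norm (a, \<eta>) = \<bar>A1\<bar> + \<bar>A2\<bar> + linf_norm (\<lambda>m. 5 ^ m * remainder a A1 A2 m)
     + Lip_norm (\<lambda>m. 3 ^ m * \<eta> m)"
proof -
  have "(THE (A1, A2). in_linf (\<lambda>m. 5 ^ m * remainder a A1 A2 m)) = (A1, A2)"
    by (rule the_equality)
      (use assms remainder_unique[OF in_linf_decay in_linf_decay] in \<open>auto split: prod.splits\<close>)
  then show ?thesis unfolding T_inf_norm_def by simp
qed

lemma T_2_norm_eq:
  assumes "in_l2 (\<lambda>m. (25/3) powr (real m / 2) * remainder a A1 A2 m)"
  shows "T_2_norm (a, \<eta>) = sqrt (A1\<^sup>2 + A2\<^sup>2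
     + (l2_norm (\<lambda>m. (25/3) powr (real m / 2) * remainder a A1 A2 m))\<^sup>2
     + (l2_norm (\<lambda>m. 3 powr (real m / 2) * \<eta> m))\<^sup>2)"
proof -
  have "(THE (A1, A2). in_l2 (\<lambda>m. (25/3) powr (real m / 2) * remainder a A1 A2 m)) = (A1, A2)"
    by (rule the_equality)
      (use assms remainder_unique[OF in_l2_decay in_l2_decay] in \<open>auto split: prod.splits\<close>)
  then show ?thesis unfolding T_2_norm_def by simp
qed

section \<open>The restriction theorem\<close>

context gasket_measure
begin

lemma Linf_AE_bound:
  assumes "g \<in> Linf_space \<mu>"
  shows "AE x in \<mu>. \<bar>g x\<bar> \<le> Linf_norm \<mu> g" "0 \<le> Linf_norm \<mu> g"
proof -
  let ?e = "esssup \<mu> (\<lambda>x. ereal \<bar>g x\<bar>)"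
  have m: "(\<lambda>x. ereal \<bar>g x\<bar>) \<in> borel_measurable \<mu>" "?e < \<infinity>"
    using assms unfolding Linf_space_def by auto
  have "esssup \<mu> (\<lambda>x. 0 :: ereal) \<le> ?e" by (rule esssup_mono) simp_all
  moreover have "esssup \<mu> (\<lambda>x. 0 :: ereal) = 0"
    by (rule esssup_const) (simp add: emeasure_space_1)
  ultimately have "0 \<le> ?e" by (simp only:)
  with m(2) obtain r where r: "?e = ereal r" "0 \<le> r"
    by (cases ?e) (auto simp: zero_ereal_def)
  have e: "ereal (Linf_norm \<mu> g) = ?e" unfolding Linf_norm_def r by simp
  show "0 \<le> Linf_norm \<mu> g" unfolding Linf_norm_def r using r(2) by simp
  have "AE x in \<mu>. ereal \<bar>g x\<bar> \<le> ?e" by (rule esssup_AE)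
  then show "AE x in \<mu>. \<bar>g x\<bar> \<le> Linf_norm \<mu> g" unfolding e[symmetric] by simp
qed

lemma Linf_L2:
  assumes g: "g \<in> Linf_space \<mu>"
  shows "g \<in> L2_space \<mu>" "L2_norm \<mu> g \<le> Linf_norm \<mu> g"
proof -
  have m: "g \<in> borel_measurable \<mu>" using g unfolding Linf_space_def by blast
  have AE: "AE x in \<mu>. (g x)\<^sup>2 \<le> (Linf_norm \<mu> g)\<^sup>2"
    using Linf_AE_bound(1)[OF g]
  proof (rule AE_mp, intro AE_I2 impI)
    fix x assume "x \<in> space \<mu>" "\<bar>g x\<bar> \<le> Linf_norm \<mu> g"
    then show "(g x)\<^sup>2 \<le> (Linf_norm \<mu> g)\<^sup>2" using power_mono[of "\<bar>g x\<bar>" _ 2] by simp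
  qed
  have int: "integrable \<mu> (\<lambda>x. (g x)\<^sup>2)"
    by (rule integrable_const_bound[of _ "(Linf_norm \<mu> g)\<^sup>2"]) (use AE m in auto)
  then show "g \<in> L2_space \<mu>" using m unfolding L2_space_def by simp
  have "(LINT x|\<mu>. (g x)\<^sup>2) \<le> (LINT x|\<mu>. (Linf_norm \<mu> g)\<^sup>2)"
    by (rule integral_mono_AE[OF int _ AE]) simp
  also have "\<dots> = (Linf_norm \<mu> g)\<^sup>2" by (simp add: prob_space)
  finally have "sqrt (LINT x|\<mu>. (g x)\<^sup>2) \<le> sqrt ((Linf_norm \<mu> g)\<^sup>2)" by (rule real_sqrt_le_mono)
  then show "L2_norm \<mu> g \<le> Linf_norm \<mu> g"
    using Linf_AE_bound(2)[OF g] unfolding L2_norm_def by simp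
qed

lemma continuous_Linf:
  assumes "continuous_on K u" shows "u \<in> Linf_space \<mu>"
proof -
  have c: "continuous_on K (\<lambda>x. \<bar>u x\<bar>)" by (intro continuous_intros assms)
  obtain B where B: "\<And>x. x \<in> K \<Longrightarrow> \<bar>u x\<bar> \<le> B"
    using continuous_attains_sup[OF compact_SG _ c] vertex_in_SG[of 0] by blast
  have m: "u \<in> borel_measurable \<mu>" by (rule continuous_measurable[OF assms])
  have "esssup \<mu> (\<lambda>x. ereal \<bar>u x\<bar>) \<le> ereal B"
  proof (rule esssup_I)
    show "(\<lambda>x. ereal \<bar>u x\<bar>) \<in> borel_measurable \<mu>" using m by simp
    show "AE x in \<mu>. ereal \<bar>u x\<bar> \<le> ereal B" using B by (intro AE_I2) (simp add: space_mu)
  qed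
  also have "\<dots> < \<infinity>" by simp
  finally show ?thesis unfolding Linf_space_def using m by simp
qed

lemma dom_laplacian_solution:
  assumes u: "u \<in> sg_dom_laplacian q \<mu> X" and X: "X \<subseteq> L2_space \<mu>"
  shows "continuous_on K u" "sg_laplacian q \<mu> X u \<in> X" "weak_solution q \<mu> u (sg_laplacian q \<mu> X u)"
proof -
  show "continuous_on K u"
    using u unfolding sg_dom_laplacian_def sg_dom_energy_def by blast
  have "\<exists>f. f \<in> X \<and> sg_weak_laplacian q \<mu> u f"
    using u unfolding sg_dom_laplacian_def by blast
  then have f: "sg_laplacian q \<mu> X u \<in> X \<and> sg_weak_laplacian q \<mu> u (sg_laplacian q \<mu> X u)"
    unfolding sg_laplacian_def by (rule someI_ex)
  then show "sg_laplacian q \<mu> X u \<in> X" by blast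
  show "weak_solution q \<mu> u (sg_laplacian q \<mu> X u)"
    by unfold_locales (use f X in auto)
qed

text \<open>On a probability space the square norms are at most the supremum norms, so the bound for the corner
  values serves here too.\<close>

lemma restriction_Linf:
  assumes u: "u \<in> sg_dom_laplacian q \<mu> (Linf_space \<mu>)"
  shows "convergent (normal_quotient q u (Y_word m) 2)" (is ?C)
    and "sg_restriction q u \<in> T_inf" (is ?T)
    and "T_inf_norm (sg_restriction q u)
      \<le> 49 * Linf_norm \<mu> u + 49 * Linf_norm \<mu> (sg_laplacian q \<mu> (Linf_space \<mu>) u)" (is ?N)
proof -
  define f where "f = sg_laplacian q \<mu> (Linf_space \<mu>) u"
  have "Linf_space \<mu> \<subseteq> L2_space \<mu>" using Linf_L2(1) by blast
  from dom_laplacian_solution[OF u this] have cont: "continuous_on K u" and f: "f \<in> Linf_space \<mu>"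
    and sol: "weak_solution q \<mu> u f" unfolding f_def by blast+
  interpret weak_solution q \<mu> u f by (rule sol)
  show ?C by (rule quotient_convergent)
  define U A where "U = Linf_norm \<mu> u" and "A = Linf_norm \<mu> f"
  note U = Linf_AE_bound(2)[OF continuous_Linf[OF cont], folded U_def]
  note A = Linf_AE_bound[OF f, folded A_def]
  have corner: "\<bar>u (q i)\<bar> \<le> 11 * U + 8 * A" for i
    using corner_values[OF cont, of i] Linf_L2(2)[OF f] Linf_L2(2)[OF continuous_Linf[OF cont]]
    unfolding U_def A_def f_sq_def L2_norm_def by linarith
  obtain \<nu> where \<nu>: "\<bar>\<nu>\<bar> \<le> 4 * (11 * U + 8 * A) + 3/2 * A"
    and rem: "\<And>m. m \<ge> 1 \<Longrightarrow> \<bar>5 ^ m * remainder (\<lambda>m. u (X_point q m)) (u (q 0)) (- 2/3 * \<nu>) m\<bar> \<le> 9/2 * A"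
    and lip: "\<And>m. m \<ge> 1 \<Longrightarrow> \<bar>3 ^ (m + 1) * normal_deriv q u (Y_word (m + 1)) 2
       - 3 ^ m * normal_deriv q u (Y_word m) 2\<bar> \<le> 11 * A"
    using trace_Linf[OF corner A] by blast
  let ?r = "\<lambda>m. 5 ^ m * remainder (\<lambda>m. u (X_point q m)) (u (q 0)) (- 2/3 * \<nu>) m"
    and ?d = "\<lambda>m. 3 ^ m * normal_deriv q u (Y_word m) 2"
  have R: "in_linf ?r" "linf_norm ?r \<le> 9/2 * A" "in_Lip ?d" "Lip_norm ?d \<le> 11 * A"
    by (rule linf_bounded Lip_bounded, erule rem lip)+
  show ?T unfolding sg_restriction_def T_inf_def using R(1,3) by blast
  have "T_inf_norm (sg_restriction q u) \<le> \<bar>u (q 0)\<bar> + \<bar>- 2/3 * \<nu>\<bar> + 9/2 * A + 11 * A"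
    unfolding sg_restriction_def T_inf_norm_eq[OF R(1)] by (intro add_mono R order_refl)
  also have "\<bar>- 2/3 * \<nu>\<bar> = 2/3 * \<bar>\<nu>\<bar>" by (simp add: abs_mult)
  also have "\<bar>u (q 0)\<bar> + 2/3 * \<bar>\<nu>\<bar> + 9/2 * A + 11 * A \<le> 49 * U + 49 * A"
    using corner[of 0] \<nu> U A(2) by argo
  finally show ?N unfolding U_def A_def f_def .
qed

lemma restriction_L2:
  assumes u: "u \<in> sg_dom_laplacian q \<mu> (L2_space \<mu>)"
  shows "convergent (normal_quotient q u (Y_word m) 2)" (is ?C)
    and "sg_restriction q u \<in> T_2" (is ?T)
    and "T_2_norm (sg_restriction q u) \<le> 174 * dom_L2_norm q \<mu> u" (is ?N)
    and "L2_norm \<mu> u \<le> Linf_norm \<mu> u" (is ?U)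
proof -
  define f where "f = sg_laplacian q \<mu> (L2_space \<mu>) u"
  from dom_laplacian_solution[OF u subset_refl] have cont: "continuous_on K u"
    and sol: "weak_solution q \<mu> u f" unfolding f_def by blast+
  interpret weak_solution q \<mu> u f by (rule sol)
  show ?C by (rule quotient_convergent)
  show ?U by (rule Linf_L2(2)[OF continuous_Linf[OF cont]])
  define U where "U = L2_norm \<mu> u"
  define M where "M = 11 * U + 8 * sqrt f_sq"
  have corner: "\<bar>u (q i)\<bar> \<le> M" for i
    unfolding M_def U_def by (rule corner_values[OF cont])
  obtain \<nu> where \<nu>: "\<nu>\<^sup>2 \<le> 32 * M\<^sup>2 + 42 * f_sq"
    and rem: "\<And>N. (\<Sum>n<N. (25/3) ^ Suc n * (remainder (\<lambda>m. u (X_point q m)) (u (q 0)) (- 2/3 * \<nu>) (Suc n))\<^sup>2)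
      \<le> 84 * f_sq"
    and der: "\<And>N. (\<Sum>n<N. 3 ^ Suc n * (normal_deriv q u (Y_word (Suc n)) 2)\<^sup>2) \<le> 108 * M\<^sup>2 + 640 * f_sq"
    using trace_L2[OF corner] by blast
  let ?a = "\<lambda>m. (25/3) powr (real m / 2) * remainder (\<lambda>m. u (X_point q m)) (u (q 0)) (- 2/3 * \<nu>) m"
  let ?b = "\<lambda>m. 3 powr (real m / 2) * normal_deriv q u (Y_word m) 2"
  have h: "((25/3::real) powr (real m / 2))\<^sup>2 = (25/3) ^ m" "((3::real) powr (real m / 2))\<^sup>2 = 3 ^ m" for m
    by (rule half_powr, simp)+
  have "(\<Sum>n<N. (?a (Suc n))\<^sup>2) \<le> 84 * f_sq" for N
    using rem[of N] unfolding power_mult_distrib h(1) .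
  then have a: "in_l2 ?a" "(l2_norm ?a)\<^sup>2 \<le> 84 * f_sq" by (rule l2_bounded)+
  have "(\<Sum>n<N. (?b (Suc n))\<^sup>2) \<le> 108 * M\<^sup>2 + 640 * f_sq" for N
    using der[of N] unfolding power_mult_distrib h(2) .
  then have b: "in_l2 ?b" "(l2_norm ?b)\<^sup>2 \<le> 108 * M\<^sup>2 + 640 * f_sq" by (rule l2_bounded)+
  show ?T unfolding sg_restriction_def T_2_def using a(1) b(1) by blast
  have "(u (q 0))\<^sup>2 \<le> M\<^sup>2" using power_mono[OF corner[of 0], of 2] by simp
  moreover have "(- 2/3 * \<nu>)\<^sup>2 \<le> 15 * M\<^sup>2 + 19 * f_sq"
  proof -
    have "(- 2/3 * \<nu>)\<^sup>2 = 4/9 * \<nu>\<^sup>2" by (simp add: power2_eq_square)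
    then show ?thesis using \<nu> f_sq_nonneg zero_le_power2[of M] by linarith
  qed
  moreover have "M\<^sup>2 \<le> 242 * U\<^sup>2 + 128 * f_sq"
    using square_add_le[of "11 * U" "8 * sqrt f_sq"] f_sq_nonneg
    unfolding M_def by (simp add: power_mult_distrib)
  \<comment> \<open>The coefficients sum to at most 30008; 30276 is the next square of an integer.\<close>
  ultimately have "(u (q 0))\<^sup>2 + (- 2/3 * \<nu>)\<^sup>2 + (l2_norm ?a)\<^sup>2 + (l2_norm ?b)\<^sup>2
      \<le> 30276 * (U\<^sup>2 + f_sq)"
    using a(2) b(2) f_sq_nonneg zero_le_power2[of U] by argo
  then have "T_2_norm (sg_restriction q u) \<le> sqrt (30276 * (U\<^sup>2 + f_sq))"
    unfolding sg_restriction_def T_2_norm_eq[OF a(1)] by (rule real_sqrt_le_mono)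
  also have "\<dots> = 174 * sqrt (U\<^sup>2 + f_sq)"
  proof -
    have "sqrt 30276 = (174::real)" by (rule real_sqrt_unique) simp_all
    then show ?thesis by (simp only: real_sqrt_mult)
  qed
  also have "f_sq = (L2_norm \<mu> f)\<^sup>2" unfolding L2_norm_def f_sq_def by simp
  finally show ?N unfolding dom_L2_norm_def U_def f_def .
qed

end

theorem theorem6p1:
  fixes q :: "3 \<Rightarrow> real^2" and \<mu> :: "(real^2) measure"
  assumes "equilateral q" and "sg_self_similar_measure q \<mu>"
  shows
    "((\<forall>u \<in> sg_dom_laplacian q \<mu> (Linf_space \<mu>).
         (\<forall>m\<ge>1. convergent (normal_quotient q u (Y_word m) 2)) \<and> sg_restriction q u \<in> T_inf) \<and>
      (\<exists>C. \<forall>u \<in> sg_dom_laplacian q \<mu> (Linf_space \<mu>).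
         T_inf_norm (sg_restriction q u) \<le> C * dom_Linf_norm q \<mu> u) \<and>
      (\<exists>C1 C2. \<forall>u \<in> sg_dom_laplacian q \<mu> (Linf_space \<mu>).
         T_inf_norm (sg_restriction q u)
           \<le> C1 * Linf_norm \<mu> u + C2 * Linf_norm \<mu> (sg_laplacian q \<mu> (Linf_space \<mu>) u)))
     \<and>
     ((\<forall>u \<in> sg_dom_laplacian q \<mu> (L2_space \<mu>).
         (\<forall>m\<ge>1. convergent (normal_quotient q u (Y_word m) 2)) \<and> sg_restriction q u \<in> T_2) \<and>
      (\<exists>C. \<forall>u \<in> sg_dom_laplacian q \<mu> (L2_space \<mu>).
         T_2_norm (sg_restriction q u) \<le> C * dom_L2_norm q \<mu> u) \<and>
      (\<exists>C1 C2. \<forall>u \<in> sg_dom_laplacian q \<mu> (L2_space \<mu>).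
         T_2_norm (sg_restriction q u)
           \<le> C1 * Linf_norm \<mu> u + C2 * L2_norm \<mu> (sg_laplacian q \<mu> (L2_space \<mu>) u)))"
proof -
  interpret gasket_measure q \<mu>
    by unfold_locales (use assms in auto)
  have Linf: "T_inf_norm (sg_restriction q u)
      \<le> 49 * Linf_norm \<mu> u + 49 * Linf_norm \<mu> (sg_laplacian q \<mu> (Linf_space \<mu>) u)"
    "T_inf_norm (sg_restriction q u) \<le> 49 * dom_Linf_norm q \<mu> u"
    if "u \<in> sg_dom_laplacian q \<mu> (Linf_space \<mu>)" for u
    using restriction_Linf(3)[OF that] unfolding dom_Linf_norm_def by simp_all
  have L2: "T_2_norm (sg_restriction q u)
      \<le> 174 * Linf_norm \<mu> u + 174 * L2_norm \<mu> (sg_laplacian q \<mu> (L2_space \<mu>) u)"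
    if u: "u \<in> sg_dom_laplacian q \<mu> (L2_space \<mu>)" for u
  proof -
    have "dom_L2_norm q \<mu> u \<le> L2_norm \<mu> u + L2_norm \<mu> (sg_laplacian q \<mu> (L2_space \<mu>) u)"
      unfolding dom_L2_norm_def by (rule sqrt_sum_squares_le_sum) (simp_all add: L2_norm_def)
    then show ?thesis using restriction_L2(3,4)[OF u] by linarith
  qed
  show ?thesis
    using restriction_Linf(1,2) Linf restriction_L2(1-3) L2 by blast
qed

end
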